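(* Let $M$ be a smooth manifold with $\dim M=n\geq 3$ and let $\mathbf{G}$ be a spray of scalar curvature on $M$. Then for every volume form $dV$ on $M$, the Berwald-Weyl curvature of $(\mathbf{G},dV)$ vanishes: $\mathbf{W}^{o}=0$.
   Context: Let $(x^i,y^i)$ be standard local coordinates on $TM$, $TM_0=TM\setminus\{0\}$; the summation convention is used and $f_{\cdot k}=\partial f/\partial y^k$. Spray: a smooth vector field on $TM_0$ of the local form $\mathbf{G}=y^{i}\frac{\partial}{\partial x^{i}}-2G^{i}\frac{\partial}{\partial y^{i}}$ with $G^i(x,\lambda y)=\lambda^2G^i(x,y)$ for all $\lambda>0$. Put $N^i_j=\partial G^i/\partial y^j$, $\Gamma^i_{jk}=\partial^2G^i/\partial y^j\partial y^k$ (Berwald connection), $\frac{\delta}{\delta x^k}=\frac{\partial}{\partial x^k}-N^l_k\frac{\partial}{\partial y^l}$. The horizontal covariant derivative with respect to $\mathbf{G}$ is that of the Berwald connection: $f_{|k}=\frac{\delta f}{\delta x^k}$, $A_{k|m}=\frac{\delta A_k}{\delta x^m}-\Gamma^l_{km}A_l$, etc. Curvatures: Riemann curvature $R^{i}_{~k}=2\frac{\partial G^{i}}{\partial x^{k}}-y^{j}\frac{\partial^{2} G^{i}}{\partial x^{j}\partial y^{k}}+2G^{j}\frac{\partial^{2} G^{i}}{\partial y^{j}\partial y^{k}}-\frac{\partial G^{i}}{\partial y^{s}}\frac{\partial G^{s}}{\partial y^{k}}$; Ricci curvature $\mathbf{Ric}_{G}=R^m_{~m}$; Ricci scalar $R=\frac{1}{n-1}\mathbf{Ric}_G$.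 $\mathbf{G}$ is of scalar curvature if $R^i_{~k}=R\,\delta^i_k-\tau_k y^i$ on $TM_0$ for some locally defined functions $\tau_k(x,y)$ (the components of a covector). It is well known that this is equivalent to the vanishing of the Weyl curvature $W^i_{~k}=R^i_{~k}-(R\delta^i_k-\frac12R_{\cdot k}y^i)+\frac{3\chi_k}{n+1}y^i$, where $\chi_k=-\frac13T^m_{~k\cdot m}$ and $T^i_{~k}=R^i_{~k}-(R\delta^i_k-\frac12R_{\cdot k}y^i)$. For a volume form $dV=\sigma(x)dx^1\cdots dx^n$ ($\sigma>0$), the S-curvature of $(\mathbf{G},dV)$ is $\mathbf{S}=\frac{\partial G^m}{\partial y^m}-y^m\frac{\partial}{\partial x^m}(\ln\sigma)$. The associated projective spray is $\hat{\mathbf{G}}=\mathbf{G}+\frac{2\mathbf{S}}{n+1}\mathbf{Y}$, $\mathbf{Y}=y^i\frac{\partial}{\partial y^i}$, i.e. $\hat G^i=G^i-\frac{\mathbf{S}}{n+1}y^i$. Let $\hat R=\frac1{n-1}\mathbf{Ric}_{\hat G}$ be the Ricci scalar of $\hat{\mathbf{G}}$, and let $\parallel$ denote the horizontal covariant derivative with respect to $\hat{\mathbf{G}}$ (defined as $|$ with $\hat G^i$ in place of $G^i$). The Berwald-Weyl curvature $\mathbf{W}^o=W^o_kdx^k$ of $(\mathbf{G},dV)$ is $W^o_k=\hat R_{\parallel k}-\frac12\hat R_{\cdot k\parallel m}y^m$. *)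

theory Defs
  imports "HOL-Analysis.Analysis"
begin

section \<open>Smooth maps on open sets\<close>

text \<open>All derivatives are Frechet derivatives at points of an open set. Iterating directional
  derivatives in arbitrary directions captures all mixed partial derivatives.\<close>

fun Ck_on :: "nat \<Rightarrow> 'a::real_normed_vector set \<Rightarrow> ('a \<Rightarrow> 'b::real_normed_vector) \<Rightarrow> bool" where
  "Ck_on 0 S f \<longleftrightarrow> continuous_on S f"
| "Ck_on (Suc k) S f \<longleftrightarrow>
     (\<forall>x\<in>S. f differentiable (at x)) \<and> (\<forall>v. Ck_on k S (\<lambda>x. frechet_derivative f (at x) v))"

definition smooth_on :: "'a::real_normed_vector set \<Rightarrow> ('a \<Rightarrow> 'b::real_normed_vector) \<Rightarrow> bool" where
  "smooth_on S f \<longleftrightarrow> (\<forall>k. Ck_on k S f)"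


section \<open>Smooth manifolds\<close>

text \<open>A chart is a pair of a domain and a coordinate map; values of the coordinate map outside
  the domain are irrelevant. The dimension of the manifold is the cardinality of the index type.\<close>

type_synonym ('m, 'n) chart = "'m set \<times> ('m \<Rightarrow> real ^ 'n)"

abbreviation chart_image :: "('m, 'n::finite) chart \<Rightarrow> (real ^ 'n) set" where
  "chart_image c \<equiv> snd c ` fst c"

definition overlap :: "('m, 'n::finite) chart \<Rightarrow> ('m, 'n) chart \<Rightarrow> (real ^ 'n) set" where
  "overlap c d = snd c ` (fst c \<inter> fst d)"

definition transition :: "('m, 'n::finite) chart \<Rightarrow> ('m, 'n) chart \<Rightarrow> real ^ 'n \<Rightarrow> real ^ 'n" where
  "transition c d = snd d \<circ> inv_into (fst c) (snd c)"

definition is_chart :: "'m topology \<Rightarrow> ('m, 'n::finite) chart \<Rightarrow> bool" where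
  "is_chart X c \<longleftrightarrow> openin X (fst c) \<and> open (chart_image c) \<and>
     homeomorphic_map (subtopology X (fst c)) (top_of_set (chart_image c)) (snd c)"

text \<open>The atlas need not be maximal, but it may be.\<close>

definition smooth_manifold :: "'m topology \<Rightarrow> ('m, 'n::finite) chart set \<Rightarrow> bool" where
  "smooth_manifold X A \<longleftrightarrow> Hausdorff_space X \<and> second_countable X \<and>
     (\<forall>c\<in>A. is_chart X c) \<and> (\<Union>c\<in>A. fst c) = topspace X \<and>
     (\<forall>c\<in>A. \<forall>d\<in>A. smooth_on (overlap c d) (transition c d))"


section \<open>Sprays and volume forms\<close>

text \<open>A chart \<open>c\<close> induces the standard coordinates \<open>(x, y)\<close> on the tangent bundle over its
  domain, and the slit tangent bundle is covered by the sets \<open>slit c\<close>, glued along the tangent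
  maps of the coordinate changes. Geometric objects are families of local representatives, indexed
  by the charts and compatible with this gluing.\<close>

type_synonym 'n tpoint = "(real ^ 'n) \<times> (real ^ 'n)"

definition slit :: "('m, 'n::finite) chart \<Rightarrow> 'n tpoint set" where
  "slit c = chart_image c \<times> (UNIV - {0})"

definition tangent_map :: "(real ^ 'n::finite \<Rightarrow> real ^ 'n) \<Rightarrow> 'n tpoint \<Rightarrow> 'n tpoint" where
  "tangent_map t p = (t (fst p), frechet_derivative t (at (fst p)) (snd p))"

definition slit_vector_field ::
    "('m, 'n::finite) chart set \<Rightarrow> (('m, 'n) chart \<Rightarrow> 'n tpoint \<Rightarrow> 'n tpoint) \<Rightarrow> bool" where
  "slit_vector_field A G \<longleftrightarrow>
     (\<forall>c\<in>A. smooth_on (slit c) (G c)) \<and>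
     (\<forall>c\<in>A. \<forall>d\<in>A. \<forall>p \<in> overlap c d \<times> (UNIV - {0}).
        G d (tangent_map (transition c d) p) =
        frechet_derivative (tangent_map (transition c d)) (at p) (G c p))"

text \<open>The functions \<open>G\<^sup>i\<close> in
  \<open>y\<^sup>i \<partial>/\<partial>x\<^sup>i - 2 G\<^sup>i \<partial>/\<partial>y\<^sup>i\<close>.\<close>

definition spray_coeff :: "('n::finite tpoint \<Rightarrow> 'n tpoint) \<Rightarrow> 'n tpoint \<Rightarrow> real ^ 'n" where
  "spray_coeff V p = - (1 / 2) *\<^sub>R snd (V p)"

definition spray ::
    "('m, 'n::finite) chart set \<Rightarrow> (('m, 'n) chart \<Rightarrow> 'n tpoint \<Rightarrow> 'n tpoint) \<Rightarrow> bool" where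
  "spray A G \<longleftrightarrow> slit_vector_field A G \<and>
     (\<forall>c\<in>A. \<forall>(x, y)\<in>slit c. fst (G c (x, y)) = y \<and>
        (\<forall>r>0. spray_coeff (G c) (x, r *\<^sub>R y) = r\<^sup>2 *\<^sub>R spray_coeff (G c) (x, y)))"

text \<open>A volume form is given by smooth densities \<open>\<sigma> > 0\<close>, one in each chart. They transform with
  the absolute value of the Jacobian determinant, so that \<open>\<sigma>\<close> is positive in every chart and no
  orientation is needed; on an oriented manifold these are exactly the positive volume forms.\<close>

definition volume_form ::
    "('m, 'n::finite) chart set \<Rightarrow> (('m, 'n) chart \<Rightarrow> real ^ 'n \<Rightarrow> real) \<Rightarrow> bool" where
  "volume_form A \<sigma> \<longleftrightarrow>
     (\<forall>c\<in>A. smooth_on (chart_image c) (\<sigma> c) \<and> (\<forall>x\<in>chart_image c. \<sigma> c x > 0)) \<and>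
     (\<forall>c\<in>A. \<forall>d\<in>A. \<forall>x\<in>overlap c d.
        \<sigma> c x = \<sigma> d (transition c d x) *
          \<bar>det (jacobian (transition c d) (at x))\<bar>)"


section \<open>Local curvature expressions\<close>

definition dx :: "'n::finite \<Rightarrow> ('n tpoint \<Rightarrow> real) \<Rightarrow> 'n tpoint \<Rightarrow> real" where
  "dx k f p = frechet_derivative f (at p) (axis k 1, 0)"

definition dy :: "'n::finite \<Rightarrow> ('n tpoint \<Rightarrow> real) \<Rightarrow> 'n tpoint \<Rightarrow> real" where
  "dy k f p = frechet_derivative f (at p) (0, axis k 1)"

text \<open>From here on \<open>V\<close> is the representative of a spray in one chart.\<close>

definition Gc :: "('n::finite tpoint \<Rightarrow> 'n tpoint) \<Rightarrow> 'n \<Rightarrow> 'n tpoint \<Rightarrow> real" where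
  "Gc V i p = spray_coeff V p $ i"

definition Nc :: "('n::finite tpoint \<Rightarrow> 'n tpoint) \<Rightarrow> 'n \<Rightarrow> 'n \<Rightarrow> 'n tpoint \<Rightarrow> real" where
  "Nc V i j = dy j (Gc V i)"

definition berwald_conn :: "('n::finite tpoint \<Rightarrow> 'n tpoint) \<Rightarrow> 'n \<Rightarrow> 'n \<Rightarrow> 'n \<Rightarrow> 'n tpoint \<Rightarrow> real" where
  "berwald_conn V i j k = dy j (dy k (Gc V i))"

definition delta ::
    "('n::finite tpoint \<Rightarrow> 'n tpoint) \<Rightarrow> 'n \<Rightarrow> ('n tpoint \<Rightarrow> real) \<Rightarrow> 'n tpoint \<Rightarrow> real" where
  "delta V k f p = dx k f p - (\<Sum>l\<in>UNIV. Nc V l k p * dy l f p)"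

text \<open>Horizontal covariant derivatives \<open>f\<^sub>|\<^sub>k\<close> of a function and \<open>A\<^sub>k\<^sub>|\<^sub>m\<close> of a covector.\<close>

definition hcov_fun ::
    "('n::finite tpoint \<Rightarrow> 'n tpoint) \<Rightarrow> ('n tpoint \<Rightarrow> real) \<Rightarrow> 'n \<Rightarrow> 'n tpoint \<Rightarrow> real" where
  "hcov_fun V f k = delta V k f"

definition hcov_covec ::
    "('n::finite tpoint \<Rightarrow> 'n tpoint) \<Rightarrow> ('n \<Rightarrow> 'n tpoint \<Rightarrow> real) \<Rightarrow> 'n \<Rightarrow> 'n \<Rightarrow> 'n tpoint \<Rightarrow> real" where
  "hcov_covec V A k m p = delta V m (A k) p - (\<Sum>l\<in>UNIV. berwald_conn V l k m p * A l p)"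

definition Riem :: "('n::finite tpoint \<Rightarrow> 'n tpoint) \<Rightarrow> 'n \<Rightarrow> 'n \<Rightarrow> 'n tpoint \<Rightarrow> real" where
  "Riem V i k p =
     2 * dx k (Gc V i) p
     - (\<Sum>j\<in>UNIV. snd p $ j * dx j (dy k (Gc V i)) p)
     + 2 * (\<Sum>j\<in>UNIV. Gc V j p * dy j (dy k (Gc V i)) p)
     - (\<Sum>s\<in>UNIV. dy s (Gc V i) p * dy k (Gc V s) p)"

definition Ric :: "('n::finite tpoint \<Rightarrow> 'n tpoint) \<Rightarrow> 'n tpoint \<Rightarrow> real" where
  "Ric V p = (\<Sum>m\<in>UNIV. Riem V m m p)"

definition ricci_scalar :: "('n::finite tpoint \<Rightarrow> 'n tpoint) \<Rightarrow> 'n tpoint \<Rightarrow> real" where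
  "ricci_scalar V p = 1 / (real CARD('n) - 1) * Ric V p"

definition S_curvature ::
    "('n::finite tpoint \<Rightarrow> 'n tpoint) \<Rightarrow> (real ^ 'n \<Rightarrow> real) \<Rightarrow> 'n tpoint \<Rightarrow> real" where
  "S_curvature V s p =
     (\<Sum>m\<in>UNIV. dy m (Gc V m) p) - (\<Sum>m\<in>UNIV. snd p $ m * dx m (\<lambda>q. ln (s (fst q))) p)"

text \<open>Here \<open>(0, snd p)\<close> is the value at \<open>p\<close> of the Liouville field
  \<open>y\<^sup>i \<partial>/\<partial>y\<^sup>i\<close>.\<close>

definition projective_spray ::
    "('n::finite tpoint \<Rightarrow> 'n tpoint) \<Rightarrow> (real ^ 'n \<Rightarrow> real) \<Rightarrow> 'n tpoint \<Rightarrow> 'n tpoint" where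
  "projective_spray V s p =
     V p + (2 * S_curvature V s p / (real CARD('n) + 1)) *\<^sub>R (0, snd p)"

definition berwald_weyl ::
    "('n::finite tpoint \<Rightarrow> 'n tpoint) \<Rightarrow> (real ^ 'n \<Rightarrow> real) \<Rightarrow> 'n \<Rightarrow> 'n tpoint \<Rightarrow> real" where
  "berwald_weyl V s k p =
     (let H = projective_spray V s; R = ricci_scalar H
      in hcov_fun H R k p
         - 1 / 2 * (\<Sum>m\<in>UNIV. hcov_covec H (\<lambda>j. dy j R) k m p * snd p $ m))"

text \<open>The functions \<open>\<tau>\<^sub>k\<close> are determined pointwise by the equation, since \<open>y \<noteq> 0\<close>; hence their
  smoothness and their transformation as the components of a covector are automatic.\<close>

definition scalar_curvature ::
    "('m, 'n::finite) chart set \<Rightarrow> (('m, 'n) chart \<Rightarrow> 'n tpoint \<Rightarrow> 'n tpoint) \<Rightarrow> bool" where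
  "scalar_curvature A G \<longleftrightarrow>
     (\<forall>c\<in>A. \<exists>\<tau> :: 'n \<Rightarrow> 'n tpoint \<Rightarrow> real. \<forall>p\<in>slit c. \<forall>i k.
        Riem (G c) i k p = ricci_scalar (G c) p * (if i = k then 1 else 0) - \<tau> k p * snd p $ i)"

end

theory Submission
  imports Defs
begin

text \<open>
  The statement is local, so everything takes place in one chart. Let \<open>R\<^sup>i\<^sub>k\<^sub>l = \<delta>\<^sub>k N\<^sup>i\<^sub>l - \<delta>\<^sub>l N\<^sup>i\<^sub>k\<close> be the
  curvature of the nonlinear connection; its contraction with \<open>y\<^sup>l\<close> is the Riemann curvature, and
  conversely \<open>3 R\<^sup>i\<^sub>k\<^sub>l = \<partial>\<^sub>l R\<^sup>i\<^sub>k - \<partial>\<^sub>k R\<^sup>i\<^sub>l\<close> (\<open>curv_eq_Riem\<close>).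

  Replacing \<open>G\<^sup>i\<close> by \<open>G\<^sup>i + P y\<^sup>i\<close> changes \<open>R\<^sup>i\<^sub>k\<^sub>l\<close> only by multiples of \<open>y\<^sup>i\<close>, \<open>\<delta>\<^sup>i\<^sub>k\<close> and \<open>\<delta>\<^sup>i\<^sub>l\<close>
  (\<open>curv_H\<close>), so that the projective spray of a spray of scalar curvature is again of scalar
  curvature: \<open>R\<^sup>i\<^sub>k = R \<delta>\<^sup>i\<^sub>k - \<tau>\<^sub>k y\<^sup>i\<close> (\<open>scalar_spray_H\<close>). Besides, its S-curvature vanishes. Hence the
  trace of its Berwald connection is the closed form \<open>d (ln \<sigma>)\<close>, and \<open>\<partial>\<^sub>m R\<^sup>m\<^sub>k\<^sub>l = 0\<close>
  (\<open>divergence_curv\<close>). Expressed through \<open>R\<close> and \<open>\<tau>\<close>, this says that \<open>\<partial>\<^sub>k \<tau>\<^sub>l\<close> is symmetric; therefore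
  \<open>\<partial>\<^sub>k R = 2 \<tau>\<^sub>k\<close> and \<open>R\<^sup>i\<^sub>k\<^sub>l = \<tau>\<^sub>l \<delta>\<^sup>i\<^sub>k - \<tau>\<^sub>k \<delta>\<^sup>i\<^sub>l\<close> (\<open>dy_R\<close>, \<open>curv_eq_tau\<close>).

  For a curvature of this form in dimension at least three the Bianchi identity of the Berwald
  connection reduces, as in Schur's lemma, to the symmetry of the covariant derivative of \<open>\<tau>\<close>
  (\<open>delta_tau_sym\<close>). Then \<open>W\<^sup>o\<^sub>k = R\<^sub>|\<^sub>k - \<tau>\<^sub>k\<^sub>|\<^sub>m y\<^sup>m = R\<^sub>|\<^sub>k - (\<tau>\<^sub>m y\<^sup>m)\<^sub>|\<^sub>k = 0\<close>, as \<open>R = \<tau>\<^sub>m y\<^sup>m\<close> and \<open>y\<close> is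
  horizontally constant.
\<close>

section \<open>Smooth functions on open sets\<close>

lemma frechet_derivative_eqI:
  assumes "(f has_derivative f') (at p)"
  shows "frechet_derivative f (at p) v = f' v"
  using frechet_derivative_at[OF assms] by simp

lemma frechet_derivative_cong_open:
  assumes "open S" "p \<in> S" "\<And>q. q \<in> S \<Longrightarrow> f q = g q"
  shows "frechet_derivative f (at p) = frechet_derivative g (at p)"
proof -
  have "(f has_derivative f') (at p) \<longleftrightarrow> (g has_derivative f') (at p)" for f'
    by (metis assms has_derivative_transform_within_open)
  then show ?thesis
    by (simp add: frechet_derivative_def)
qed

lemma differentiable_cong_open:
  assumes "open S" "p \<in> S" "\<And>q. q \<in> S \<Longrightarrow> f q = g q" "f differentiable (at p)"
  shows "g differentiable (at p)"
  using assms by (metis differentiable_def has_derivative_transform_within_open)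

text \<open>On an open set only the values there matter. This makes the product, quotient and chain
  rules available inductively: the derivative of a composite agrees with its expected formula on
  \<open>S\<close>, and the formula is covered by the induction hypothesis.\<close>

lemma Ck_on_cong:
  assumes "open S"
  shows "\<lbrakk>\<And>q. q \<in> S \<Longrightarrow> f q = g q; Ck_on k S f\<rbrakk> \<Longrightarrow> Ck_on k S g"
proof (induction k arbitrary: f g)
  case 0
  then show ?case using continuous_on_eq by auto
next
  case (Suc k)
  have "Ck_on k S (\<lambda>x. frechet_derivative g (at x) v)" for v
  proof (rule Suc.IH)
    show "frechet_derivative f (at q) v = frechet_derivative g (at q) v" if "q \<in> S" for q
      using frechet_derivative_cong_open[OF assms that, of f g] Suc.prems(1) by simp
  qed (use Suc.prems in simp)
  moreover have "g differentiable (at x)" if "x \<in> S" for x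
    using differentiable_cong_open[OF assms that Suc.prems(1)] Suc.prems(2) that by simp
  ultimately show ?case by simp
qed

lemma Ck_on_SucD: "Ck_on (Suc k) S f \<Longrightarrow> Ck_on k S f"
proof (induction k arbitrary: f)
  case 0
  then show ?case
    by (simp add: continuous_at_imp_continuous_on differentiable_imp_continuous_within)
qed simp

lemma Ck_on_const: "Ck_on k S (\<lambda>_. c)"
  by (induction k arbitrary: c) auto

lemma Ck_on_add:
  assumes "open S"
  shows "\<lbrakk>Ck_on k S f; Ck_on k S g\<rbrakk> \<Longrightarrow> Ck_on k S (\<lambda>p. f p + g p)"
proof (induction k arbitrary: f g)
  case 0
  then show ?case by (auto intro: continuous_on_add)
next
  case (Suc k)
  have "Ck_on k S (\<lambda>p. frechet_derivative (\<lambda>p. f p + g p) (at p) v)" for v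
  proof (rule Ck_on_cong[OF assms _ Suc.IH])
    fix q assume "q \<in> S"
    then show "frechet_derivative f (at q) v + frechet_derivative g (at q) v
      = frechet_derivative (\<lambda>p. f p + g p) (at q) v"
      using Suc.prems
      by (intro frechet_derivative_eqI[symmetric] derivative_eq_intros) (auto simp: frechet_derivative_works)
  qed (use Suc.prems in simp_all)
  then show ?case using Suc.prems by auto
qed

lemma Ck_on_mult:
  fixes f g :: "'a::real_normed_vector \<Rightarrow> real"
  assumes "open S"
  shows "\<lbrakk>Ck_on k S f; Ck_on k S g\<rbrakk> \<Longrightarrow> Ck_on k S (\<lambda>p. f p * g p)"
proof (induction k arbitrary: f g)
  case 0
  then show ?case by (auto intro: continuous_on_mult)
next
  case (Suc k)
  have "Ck_on k S (\<lambda>p. frechet_derivative (\<lambda>p. f p * g p) (at p) v)" for v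
  proof (rule Ck_on_cong[OF assms _ Ck_on_add[OF assms Suc.IH Suc.IH]])
    fix q assume "q \<in> S"
    then show "f q * frechet_derivative g (at q) v + frechet_derivative f (at q) v * g q
      = frechet_derivative (\<lambda>p. f p * g p) (at q) v"
      using Suc.prems
      by (intro frechet_derivative_eqI[symmetric] has_derivative_mult) (auto simp: frechet_derivative_works)
  qed (use Suc.prems Ck_on_SucD in auto)
  then show ?case using Suc.prems by auto
qed

lemma Ck_on_inverse:
  fixes f :: "'a::real_normed_vector \<Rightarrow> real"
  assumes "open S" "\<And>p. p \<in> S \<Longrightarrow> f p \<noteq> 0"
  shows "Ck_on k S f \<Longrightarrow> Ck_on k S (\<lambda>p. inverse (f p))"
proof (induction k)
  case 0
  then show ?case using assms by (auto intro: continuous_on_inverse)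
next
  case (Suc k)
  have "Ck_on k S (\<lambda>p. frechet_derivative (\<lambda>p. inverse (f p)) (at p) v)" for v
  proof (rule Ck_on_cong[OF assms(1)])
    show "- 1 * (inverse (f q) * frechet_derivative f (at q) v * inverse (f q))
      = frechet_derivative (\<lambda>p. inverse (f p)) (at q) v" if "q \<in> S" for q
      using Suc.prems that assms(2)[OF that]
      by (subst frechet_derivative_eqI[OF Deriv.has_derivative_inverse]) (auto simp: frechet_derivative_works)
    show "Ck_on k S (\<lambda>q. - 1 * (inverse (f q) * frechet_derivative f (at q) v * inverse (f q)))"
      using Suc.prems Ck_on_SucD[OF Suc.prems] Suc.IH
      by (intro Ck_on_mult[OF assms(1)] Ck_on_const) auto
  qed
  then show ?case using Suc.prems assms by auto
qed

lemma Ck_on_ln: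
  fixes f :: "'a::real_normed_vector \<Rightarrow> real"
  assumes "open S" "\<And>p. p \<in> S \<Longrightarrow> f p > 0" "Ck_on k S f"
  shows "Ck_on k S (\<lambda>p. ln (f p))"
proof (cases k)
  case 0
  then show ?thesis using assms by (auto intro!: continuous_on_ln)
      (metis less_irrefl)+
next
  case (Suc k)
  have der: "((\<lambda>p. ln (f p)) has_derivative
      (\<lambda>v. frechet_derivative f (at q) v * inverse (f q))) (at q)" if "q \<in> S" for q
    using assms Suc that
    by (auto intro!: derivative_eq_intros simp: frechet_derivative_works divide_inverse)
  have "Ck_on k S (\<lambda>p. frechet_derivative (\<lambda>p. ln (f p)) (at p) v)" for v
  proof (rule Ck_on_cong[OF assms(1)])
    show "frechet_derivative f (at q) v * inverse (f q)
      = frechet_derivative (\<lambda>p. ln (f p)) (at q) v" if "q \<in> S" for q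
      using frechet_derivative_eqI[OF der[OF that]] by simp
    show "Ck_on k S (\<lambda>q. frechet_derivative f (at q) v * inverse (f q))"
      using assms Suc Ck_on_SucD
      by (intro Ck_on_mult[OF assms(1)] Ck_on_inverse) (auto simp: less_imp_neq[symmetric])
  qed
  then show ?thesis using Suc der by (auto simp: differentiable_def)
qed

lemma Ck_on_linear_comp:
  assumes "open S" "bounded_linear L"
  shows "Ck_on k S f \<Longrightarrow> Ck_on k S (\<lambda>p. L (f p))"
proof (induction k arbitrary: f)
  case 0
  then show ?case using assms by (auto intro: bounded_linear.continuous_on)
next
  case (Suc k)
  have der: "((\<lambda>p. L (f p)) has_derivative (\<lambda>v. L (frechet_derivative f (at q) v))) (at q)"
    if "q \<in> S" for q
    using Suc.prems that
    by (intro bounded_linear.has_derivative[OF assms(2)]) (auto simp: frechet_derivative_works)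
  have "Ck_on k S (\<lambda>p. frechet_derivative (\<lambda>p. L (f p)) (at p) v)" for v
    by (rule Ck_on_cong[OF assms(1) _ Suc.IH]) (use Suc.prems in \<open>auto simp: frechet_derivative_eqI[OF der]\<close>)
  then show ?case using der by (auto simp: differentiable_def)
qed

lemma Ck_on_comp_linear:
  assumes "open S" "bounded_linear L" "L ` S \<subseteq> T"
  shows "Ck_on k T f \<Longrightarrow> Ck_on k S (\<lambda>p. f (L p))"
proof (induction k arbitrary: f)
  case 0
  then show ?case using assms
    by (auto intro: continuous_on_compose2 linear_continuous_on)
next
  case (Suc k)
  have der: "((\<lambda>p. f (L p)) has_derivative (\<lambda>v. frechet_derivative f (at (L q)) (L v))) (at q)"
    if "q \<in> S" for q
  proof (rule has_derivative_compose[of L L])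
    show "(L has_derivative L) (at q)"
      by (rule bounded_linear_imp_has_derivative[OF assms(2)])
    show "(f has_derivative frechet_derivative f (at (L q))) (at (L q))"
      using Suc.prems that assms(3) by (auto simp: frechet_derivative_works)
  qed
  have "Ck_on k S (\<lambda>p. frechet_derivative (\<lambda>p. f (L p)) (at p) v)" for v
    by (rule Ck_on_cong[OF assms(1) _ Suc.IH[of "\<lambda>q. frechet_derivative f (at q) (L v)"]])
      (use Suc.prems in \<open>auto simp: frechet_derivative_eqI[OF der]\<close>)
  then show ?case using der by (auto simp: differentiable_def)
qed

lemma mvt_along_line:
  fixes f :: "'a::real_normed_vector \<Rightarrow> real"
  assumes "h > 0" "\<And>t. \<lbrakk>0 \<le> t; t \<le> h\<rbrakk> \<Longrightarrow> f differentiable (at (q + t *\<^sub>R u))"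
  obtains \<xi> where "0 < \<xi>" "\<xi> < h"
    "f (q + h *\<^sub>R u) - f q = h * frechet_derivative f (at (q + \<xi> *\<^sub>R u)) u"
proof -
  have der: "((\<lambda>t. f (q + t *\<^sub>R u)) has_real_derivative
      frechet_derivative f (at (q + t *\<^sub>R u)) u) (at t)" if "0 \<le> t" "t \<le> h" for t
  proof -
    have "((\<lambda>t. q + t *\<^sub>R u) has_derivative (\<lambda>s. s *\<^sub>R u)) (at t)"
      by (auto intro!: derivative_eq_intros)
    then have "((\<lambda>t. f (q + t *\<^sub>R u)) has_derivative
        (\<lambda>s. frechet_derivative f (at (q + t *\<^sub>R u)) (s *\<^sub>R u))) (at t)"
      using assms(2)[OF that] unfolding frechet_derivative_works
      by (rule has_derivative_compose)
    then show ?thesis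
      unfolding has_field_derivative_def
      by (simp add: linear_scale[OF linear_frechet_derivative[OF assms(2)[OF that]]] mult_commute_abs)
  qed
  from MVT2[OF \<open>h > 0\<close> der] that show thesis by auto
qed

text \<open>Two applications of the mean value theorem, first along \<open>v\<close> to the increment of \<open>f\<close> in the
  direction \<open>w\<close>, then along \<open>w\<close> to the directional derivative \<open>\<partial>\<^sub>v f\<close>. The left-hand side is
  symmetric in \<open>v\<close> and \<open>w\<close>, which is the source of the symmetry of second derivatives.\<close>

lemma second_difference_mvt:
  fixes f :: "'a::real_normed_vector \<Rightarrow> real"
  assumes "h > 0" "Ck_on 2 S f"
    "\<And>s t. \<lbrakk>0 \<le> s; s \<le> h; 0 \<le> t; t \<le> h\<rbrakk> \<Longrightarrow> p + s *\<^sub>R v + t *\<^sub>R w \<in> S"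
  obtains s t where "0 \<le> s" "s \<le> h" "0 \<le> t" "t \<le> h"
    "f (p + h *\<^sub>R v + h *\<^sub>R w) - f (p + h *\<^sub>R v) - f (p + h *\<^sub>R w) + f p
      = h\<^sup>2 * frechet_derivative (\<lambda>q. frechet_derivative f (at q) v) (at (p + s *\<^sub>R v + t *\<^sub>R w)) w"
proof -
  define g where "g = (\<lambda>q. f (q + h *\<^sub>R w) - f q)"
  have f2: "\<forall>x\<in>S. f differentiable at x"
    "\<forall>x\<in>S. (\<lambda>q. frechet_derivative f (at q) v) differentiable at x"
    using assms(2) by (auto simp: numeral_2_eq_2)
  have gder: "(g has_derivative
      (\<lambda>u. frechet_derivative f (at (q + h *\<^sub>R w)) u - frechet_derivative f (at q) u)) (at q)"
    if "q \<in> S" "q + h *\<^sub>R w \<in> S" for q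
    unfolding g_def
  proof (intro has_derivative_diff)
    have "((\<lambda>q. q + h *\<^sub>R w) has_derivative (\<lambda>u. u)) (at q)"
      by (auto intro!: derivative_eq_intros)
    then show "((\<lambda>q. f (q + h *\<^sub>R w)) has_derivative frechet_derivative f (at (q + h *\<^sub>R w))) (at q)"
      using f2 that by (auto dest: has_derivative_compose simp: frechet_derivative_works)
    show "(f has_derivative frechet_derivative f (at q)) (at q)"
      using f2 that by (simp add: frechet_derivative_works)
  qed
  have mem: "p + t *\<^sub>R v \<in> S" "p + t *\<^sub>R v + h *\<^sub>R w \<in> S" if "0 \<le> t" "t \<le> h" for t
    using assms(3)[of t 0] assms(3)[of t h] that \<open>h > 0\<close> by auto
  obtain s where s: "0 < s" "s < h" "g (p + h *\<^sub>R v) - g p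
      = h * frechet_derivative g (at (p + s *\<^sub>R v)) v"
    by (rule mvt_along_line[OF \<open>h > 0\<close>, of g p v])
       (meson differentiableI gder mem)+
  obtain t where t: "0 < t" "t < h"
    "frechet_derivative f (at (p + s *\<^sub>R v + h *\<^sub>R w)) v - frechet_derivative f (at (p + s *\<^sub>R v)) v
      = h * frechet_derivative (\<lambda>q. frechet_derivative f (at q) v) (at (p + s *\<^sub>R v + t *\<^sub>R w)) w"
    by (rule mvt_along_line[OF \<open>h > 0\<close>, of "\<lambda>q. frechet_derivative f (at q) v" "p + s *\<^sub>R v" w])
       (use f2 s assms(3) in auto)
  have "g (p + h *\<^sub>R v) - g p = h * (h * frechet_derivative
      (\<lambda>q. frechet_derivative f (at q) v) (at (p + s *\<^sub>R v + t *\<^sub>R w)) w)"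
    using s t frechet_derivative_eqI[OF gder, of "p + s *\<^sub>R v" v] mem[of s] by simp
  with s t show thesis
    by (intro that[of s t]) (auto simp: g_def power2_eq_square algebra_simps)
qed

text \<open>Schwarz's theorem. The symmetric second difference over a small parallelogram, divided by
  \<open>h\<^sup>2\<close>, is a value of either mixed derivative near \<open>p\<close>; both are continuous at \<open>p\<close>.\<close>

lemma frechet_derivative_commute:
  fixes f :: "'a::real_normed_vector \<Rightarrow> real"
  assumes "open S" "p \<in> S" "Ck_on 2 S f"
  shows "frechet_derivative (\<lambda>q. frechet_derivative f (at q) v) (at p) w
       = frechet_derivative (\<lambda>q. frechet_derivative f (at q) w) (at p) v"
proof -
  define A where "A = (\<lambda>q. frechet_derivative (\<lambda>q. frechet_derivative f (at q) v) (at q) w)"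
  define B where "B = (\<lambda>q. frechet_derivative (\<lambda>q. frechet_derivative f (at q) w) (at q) v)"
  have cont: "isCont A p" "isCont B p"
    using assms by (auto simp: numeral_2_eq_2 A_def B_def continuous_on_eq_continuous_at)
  have "\<bar>A p - B p\<bar> < e" if "e > 0" for e
  proof -
    have "(A \<longlongrightarrow> A p) (nhds p)" "(B \<longlongrightarrow> B p) (nhds p)"
      using cont by (simp_all add: isCont_def tendsto_at_iff_tendsto_nhds)
    then have "eventually (\<lambda>q. dist (A q) (A p) < e/2 \<and> dist (B q) (B p) < e/2 \<and> q \<in> S) (nhds p)"
      using assms \<open>e > 0\<close>
      by (intro eventually_conj tendstoD eventually_nhds_in_open) auto
    then obtain d where d: "d > 0"
      "\<And>q. dist q p < d \<Longrightarrow> dist (A q) (A p) < e/2 \<and> dist (B q) (B p) < e/2 \<and> q \<in> S"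
      by (auto simp: eventually_nhds_metric)
    \<comment> \<open>Small enough that the parallelogram lies in the \<open>d\<close>-ball; the summand 1 covers \<open>v = w = 0\<close>.\<close>
    define K where "K = norm v + norm w + 1"
    define h where "h = d / (2 * K)"
    have pos: "K > 0"
      by (simp add: K_def add_nonneg_pos)
    have "h > 0" using d pos by (simp add: h_def)
    have near: "dist (p + s *\<^sub>R v + t *\<^sub>R w) p < d"
      if "0 \<le> s" "s \<le> h" "0 \<le> t" "t \<le> h" for s t
    proof -
      have "dist (p + s *\<^sub>R v + t *\<^sub>R w) p \<le> s * norm v + t * norm w"
        using that norm_triangle_ineq[of "s *\<^sub>R v" "t *\<^sub>R w"] by (simp add: dist_norm add.assoc)
      also have "\<dots> \<le> h * norm v + h * norm w"
        using that by (intro add_mono mult_right_mono) auto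
      also have "\<dots> \<le> h * K"
        using \<open>h > 0\<close> by (simp add: K_def algebra_simps)
      also have "\<dots> = d / 2" using pos by (simp add: h_def)
      finally show ?thesis using d by simp
    qed
    obtain s t where st: "0 \<le> s" "s \<le> h" "0 \<le> t" "t \<le> h"
      "f (p + h *\<^sub>R v + h *\<^sub>R w) - f (p + h *\<^sub>R v) - f (p + h *\<^sub>R w) + f p
        = h\<^sup>2 * A (p + s *\<^sub>R v + t *\<^sub>R w)"
      unfolding A_def
      by (rule second_difference_mvt[OF \<open>h > 0\<close> assms(3), of p v w])
         (use near d in blast)+
    have near': "p + s *\<^sub>R w + t *\<^sub>R v \<in> S"
      if "0 \<le> s" "s \<le> h" "0 \<le> t" "t \<le> h" for s t
      using near[of t s] d(2)[of "p + t *\<^sub>R v + s *\<^sub>R w"] that by (simp add: add_ac)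
    obtain s' t' where st': "0 \<le> s'" "s' \<le> h" "0 \<le> t'" "t' \<le> h"
      "f (p + h *\<^sub>R w + h *\<^sub>R v) - f (p + h *\<^sub>R w) - f (p + h *\<^sub>R v) + f p
        = h\<^sup>2 * B (p + s' *\<^sub>R w + t' *\<^sub>R v)"
      unfolding B_def
      by (rule second_difference_mvt[OF \<open>h > 0\<close> assms(3), of p w v])
         (use near' in blast)+
    have swap: "p + a + b = p + b + a" for a b
      by (simp add: add_ac)
    have "h\<^sup>2 * A (p + s *\<^sub>R v + t *\<^sub>R w) = h\<^sup>2 * B (p + s' *\<^sub>R w + t' *\<^sub>R v)"
      using st(5) st'(5) unfolding swap[of "h *\<^sub>R w" "h *\<^sub>R v"] by linarith
    then have "A (p + s *\<^sub>R v + t *\<^sub>R w) = B (p + t' *\<^sub>R v + s' *\<^sub>R w)"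
      using \<open>h > 0\<close> swap[of "s' *\<^sub>R w"] by simp
    moreover have "dist (A (p + s *\<^sub>R v + t *\<^sub>R w)) (A p) < e/2"
      "dist (B (p + t' *\<^sub>R v + s' *\<^sub>R w)) (B p) < e/2"
      using d(2) near st(1-4) st'(1-4) by blast+
    ultimately show ?thesis
      unfolding dist_real_def by linarith
  qed
  from this[of "\<bar>A p - B p\<bar>"] have "A p = B p"
    by fastforce
  then show ?thesis by (simp add: A_def B_def)
qed


locale open_region =
  fixes S :: "'a::real_normed_vector set"
  assumes open_S: "open S"
begin

lemma smooth_cong: "\<lbrakk>\<And>q. q \<in> S \<Longrightarrow> f q = g q; smooth_on S f\<rbrakk> \<Longrightarrow> smooth_on S g"
  unfolding smooth_on_def using Ck_on_cong[OF open_S, of f g] by blast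

lemma smooth_differentiable: "\<lbrakk>smooth_on S f; p \<in> S\<rbrakk> \<Longrightarrow> f differentiable (at p)"
  unfolding smooth_on_def by (metis Ck_on.simps(2))

lemma smooth_frechet_derivative:
  "smooth_on S f \<Longrightarrow> smooth_on S (\<lambda>p. frechet_derivative f (at p) v)"
  unfolding smooth_on_def by (metis Ck_on.simps(2))

lemma smooth_const [simp]: "smooth_on S (\<lambda>_. c)"
  by (simp add: smooth_on_def Ck_on_const)

lemma smooth_add [simp]:
  "\<lbrakk>smooth_on S f; smooth_on S g\<rbrakk> \<Longrightarrow> smooth_on S (\<lambda>p. f p + g p)"
  by (simp add: smooth_on_def Ck_on_add open_S)

lemma smooth_mult [simp]:
  fixes f g :: "'a \<Rightarrow> real"
  shows "\<lbrakk>smooth_on S f; smooth_on S g\<rbrakk> \<Longrightarrow> smooth_on S (\<lambda>p. f p * g p)"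
  by (simp add: smooth_on_def Ck_on_mult open_S)

lemma smooth_minus [simp]:
  fixes f :: "'a \<Rightarrow> real"
  shows "smooth_on S f \<Longrightarrow> smooth_on S (\<lambda>p. - f p)"
  using smooth_mult[of "\<lambda>_. - 1" f] by simp

lemma smooth_diff [simp]:
  fixes f g :: "'a \<Rightarrow> real"
  shows "\<lbrakk>smooth_on S f; smooth_on S g\<rbrakk> \<Longrightarrow> smooth_on S (\<lambda>p. f p - g p)"
  using smooth_add[of f "\<lambda>p. - g p"] by simp

lemma smooth_sum [simp]:
  fixes f :: "'i \<Rightarrow> 'a \<Rightarrow> real"
  shows "(\<And>i. smooth_on S (f i)) \<Longrightarrow> smooth_on S (\<lambda>p. \<Sum>i\<in>I. f i p)"
  by (induction I rule: infinite_finite_induct) auto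

lemma smooth_inverse:
  fixes f :: "'a \<Rightarrow> real"
  shows "\<lbrakk>smooth_on S f; \<And>p. p \<in> S \<Longrightarrow> f p \<noteq> 0\<rbrakk> \<Longrightarrow> smooth_on S (\<lambda>p. inverse (f p))"
  by (simp add: smooth_on_def Ck_on_inverse open_S)

lemma smooth_bounded_linear: "bounded_linear L \<Longrightarrow> smooth_on S L"
  unfolding smooth_on_def
proof
  fix k assume L: "bounded_linear L"
  then have "L differentiable (at p)" "frechet_derivative L (at p) = L" for p
    using bounded_linear_imp_differentiable[OF L] frechet_derivative_at[OF bounded_linear_imp_has_derivative[OF L]]
    by auto
  then show "Ck_on k S L"
    by (cases k) (auto simp: Ck_on_const linear_continuous_on[OF L])
qed

lemma frechet_derivative_commute_smooth:
  fixes f :: "'a \<Rightarrow> real"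
  shows "\<lbrakk>smooth_on S f; p \<in> S\<rbrakk> \<Longrightarrow>
    frechet_derivative (\<lambda>q. frechet_derivative f (at q) v) (at p) w
    = frechet_derivative (\<lambda>q. frechet_derivative f (at q) w) (at p) v"
  by (simp add: frechet_derivative_commute[OF open_S] smooth_on_def)

end

text \<open>The operators \<open>\<partial>/\<partial>x\<^sup>k\<close>, \<open>\<partial>/\<partial>y\<^sup>k\<close>, \<open>\<delta>/\<delta>x\<^sup>k\<close> and \<open>y\<^sup>m \<partial>/\<partial>y\<^sup>m\<close> all obey the Leibniz rule;
  their common calculus is developed once. Since functions are total but equations between them
  hold on \<open>S\<close> only, locality is part of the notion.\<close>

locale derivation = open_region S for S :: "'a::real_normed_vector set" +
  fixes D :: "('a \<Rightarrow> real) \<Rightarrow> 'a \<Rightarrow> real"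
  assumes smooth [simp]: "smooth_on S f \<Longrightarrow> smooth_on S (D f)"
    and cong: "\<lbrakk>p \<in> S; \<And>q. q \<in> S \<Longrightarrow> f q = g q\<rbrakk> \<Longrightarrow> D f p = D g p"
    and const: "p \<in> S \<Longrightarrow> D (\<lambda>_. c) p = 0"
    and add: "\<lbrakk>p \<in> S; smooth_on S f; smooth_on S g\<rbrakk> \<Longrightarrow> D (\<lambda>q. f q + g q) p = D f p + D g p"
    and mult: "\<lbrakk>p \<in> S; smooth_on S f; smooth_on S g\<rbrakk>
      \<Longrightarrow> D (\<lambda>q. f q * g q) p = f p * D g p + D f p * g p"
begin

lemma scale: "\<lbrakk>p \<in> S; smooth_on S f\<rbrakk> \<Longrightarrow> D (\<lambda>q. c * f q) p = c * D f p"
  by (simp add: mult const)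

lemma minus: "\<lbrakk>p \<in> S; smooth_on S f\<rbrakk> \<Longrightarrow> D (\<lambda>q. - f q) p = - D f p"
  using scale[of p f "- 1"] by simp

lemma diff: "\<lbrakk>p \<in> S; smooth_on S f; smooth_on S g\<rbrakk> \<Longrightarrow> D (\<lambda>q. f q - g q) p = D f p - D g p"
  using add[of p f "\<lambda>q. - g q"] by (simp add: minus)

lemma sum:
  assumes "p \<in> S" "\<And>i. smooth_on S (f i)"
  shows "D (\<lambda>q. \<Sum>i\<in>I. f i q) p = (\<Sum>i\<in>I. D (f i) p)"
  by (induction I rule: infinite_finite_induct) (simp_all add: assms const add)

end

lemma (in open_region) frechet_derivation:
  "derivation S (\<lambda>f p. frechet_derivative f (at p) v)"
proof unfold_locales
  fix p and f g :: "'a \<Rightarrow> real" assume p: "p \<in> S"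
  show "frechet_derivative f (at p) v = frechet_derivative g (at p) v"
    if "\<And>q. q \<in> S \<Longrightarrow> f q = g q"
    using frechet_derivative_cong_open[OF open_S p that] by simp
  assume "smooth_on S f" "smooth_on S g"
  then have "(f has_derivative frechet_derivative f (at p)) (at p)"
    "(g has_derivative frechet_derivative g (at p)) (at p)"
    using smooth_differentiable p frechet_derivative_works by blast+
  then show "frechet_derivative (\<lambda>q. f q + g q) (at p) v
      = frechet_derivative f (at p) v + frechet_derivative g (at p) v"
    "frechet_derivative (\<lambda>q. f q * g q) (at p) v
      = f p * frechet_derivative g (at p) v + frechet_derivative f (at p) v * g p"
    using frechet_derivative_eqI[OF has_derivative_add] frechet_derivative_eqI[OF has_derivative_mult] by blast+
qed (use smooth_frechet_derivative in auto)

section \<open>The Berwald connection of a spray in one chart\<close>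

text \<open>Homogeneity of degree two enters only through Euler's equation, that is, through its
  infinitesimal form. Because \<open>y \<noteq> 0\<close> on \<open>S\<close>, factors of \<open>y\<^sup>i\<close> can be cancelled.\<close>

locale local_spray = open_region S
  for S :: "'n::finite tpoint set" +
  fixes V :: "'n tpoint \<Rightarrow> 'n tpoint"
  assumes smooth_Gc [simp]: "smooth_on S (Gc V i)"
    and Gc_euler: "p \<in> S \<Longrightarrow> (\<Sum>m\<in>UNIV. snd p $ m * dy m (Gc V i) p) = 2 * Gc V i p"
    and y_nonzero: "p \<in> S \<Longrightarrow> snd p \<noteq> 0"
begin

sublocale dx: derivation S "dx k" for k
  using frechet_derivation[of "(axis k 1, 0)"] by (simp add: dx_def[abs_def])

sublocale dy: derivation S "dy k" for k
  using frechet_derivation[of "(0, axis k 1)"] by (simp add: dy_def[abs_def])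

lemma commute:
  assumes "smooth_on S f" "p \<in> S"
  shows "dx k (dx l f) p = dx l (dx k f) p" "dy k (dy l f) p = dy l (dy k f) p"
    "dy k (dx l f) p = dx l (dy k f) p"
  using frechet_derivative_commute_smooth[OF assms]
  unfolding dx_def[abs_def] dy_def[abs_def] by blast+

lemma smooth_y [simp]: "smooth_on S (\<lambda>q. snd q $ i)"
  by (intro smooth_bounded_linear bounded_linear_compose[OF bounded_linear_vec_nth bounded_linear_snd])

lemma frechet_y: "frechet_derivative (\<lambda>q. snd q $ i) (at p) v = snd v $ i"
  by (intro frechet_derivative_eqI bounded_linear_imp_has_derivative
      bounded_linear_compose[OF bounded_linear_vec_nth bounded_linear_snd])

lemma dx_y [simp]: "dx k (\<lambda>q. snd q $ i) p = 0"
  by (simp add: dx_def frechet_y)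

lemma dy_y: "dy k (\<lambda>q. snd q $ i) p = (if k = i then 1 else 0)"
  by (simp add: dy_def frechet_y axis_def)

lemma smooth_Nc [simp]: "smooth_on S (Nc V i j)"
  by (simp add: Nc_def)

lemma smooth_conn [simp]: "smooth_on S (berwald_conn V i j k)"
  by (simp add: berwald_conn_def)

lemma conn_sym: "p \<in> S \<Longrightarrow> berwald_conn V i j k p = berwald_conn V i k j p"
  by (simp add: berwald_conn_def commute)

lemma dy_Nc: "dy j (Nc V i k) = berwald_conn V i j k"
  by (simp add: berwald_conn_def Nc_def)

lemma delta_eq: "delta V k f = (\<lambda>p. dx k f p - (\<Sum>l\<in>UNIV. Nc V l k p * dy l f p))"
  by (simp add: delta_def fun_eq_iff)

sublocale delta: derivation S "delta V k" for k
proof unfold_locales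
  show "delta V k f p = delta V k g p" if "p \<in> S" "\<And>q. q \<in> S \<Longrightarrow> f q = g q" for p f g
    unfolding delta_def using dx.cong[OF that] dy.cong[OF that] by simp
  fix p and f g :: "'n tpoint \<Rightarrow> real" assume *: "p \<in> S" "smooth_on S f" "smooth_on S g"
  show "delta V k (\<lambda>q. f q + g q) p = delta V k f p + delta V k g p"
    using * by (simp add: delta_def dx.add dy.add algebra_simps sum.distrib)
  show "delta V k (\<lambda>q. f q * g q) p = f p * delta V k g p + delta V k f p * g p"
    using * by (simp add: delta_def dx.mult dy.mult algebra_simps sum.distrib
        sum_distrib_left)
qed (simp_all add: delta_eq dx.const dy.const)

lemma delta_y: "p \<in> S \<Longrightarrow> delta V k (\<lambda>q. snd q $ i) p = - Nc V i k p"
  by (simp add: delta_def dy_y if_distrib cong: if_cong)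

text \<open>The vertical fields commute with \<open>\<partial>/\<partial>x\<^sup>k\<close> and with each other, so the commutator only
  sees the derivatives of the coefficients \<open>N\<^sup>l\<^sub>k\<close>, which are the Berwald connection.\<close>

lemma dy_delta:
  assumes "p \<in> S" "smooth_on S f"
  shows "dy m (delta V k f) p
    = delta V k (dy m f) p - (\<Sum>j\<in>UNIV. berwald_conn V j m k p * dy j f p)"
proof -
  have "dy m (delta V k f) p = dy m (dx k f) p
      - (\<Sum>l\<in>UNIV. Nc V l k p * dy m (dy l f) p + dy m (Nc V l k) p * dy l f p)"
    using assms by (simp add: delta_eq dy.diff dy.sum dy.mult)
  also have "\<dots> = dx k (dy m f) p
      - (\<Sum>l\<in>UNIV. Nc V l k p * dy l (dy m f) p + berwald_conn V l m k p * dy l f p)"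
    using assms by (simp add: commute(3) commute(2)[of f p m] dy_Nc)
  also have "\<dots> = delta V k (dy m f) p - (\<Sum>j\<in>UNIV. berwald_conn V j m k p * dy j f p)"
    by (simp add: delta_def sum.distrib)
  finally show ?thesis .
qed

text \<open>The curvature \<open>R\<^sup>i\<^sub>k\<^sub>l\<close> of the nonlinear connection \<open>N\<close>, the obstruction to integrability of
  the horizontal distribution. The sign is chosen so that \<open>R\<^sup>i\<^sub>k = R\<^sup>i\<^sub>k\<^sub>l y\<^sup>l\<close>.\<close>

definition curv :: "'n \<Rightarrow> 'n \<Rightarrow> 'n \<Rightarrow> 'n tpoint \<Rightarrow> real" where
  "curv i k l = (\<lambda>p. delta V k (Nc V i l) p - delta V l (Nc V i k) p)"

lemma smooth_curv [simp]: "smooth_on S (curv i k l)"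
  by (simp add: curv_def)

lemma curv_antisym: "curv i l k = (\<lambda>p. - curv i k l p)"
  by (simp add: curv_def)

text \<open>In \<open>\<delta>\<^sub>k\<delta>\<^sub>l f\<close> all terms with second derivatives of \<open>f\<close> are symmetric in \<open>k\<close> and \<open>l\<close>; what is
  left comes from differentiating \<open>N\<^sup>j\<^sub>l\<close>.\<close>

lemma delta_commutator:
  assumes "p \<in> S" "smooth_on S f"
  shows "delta V k (delta V l f) p - delta V l (delta V k f) p = - (\<Sum>j\<in>UNIV. curv j k l p * dy j f p)"
proof -
  have expand: "delta V k (delta V l f) p = dx k (dx l f) p
      - (\<Sum>i\<in>UNIV. Nc V i k p * dx l (dy i f) p) - (\<Sum>j\<in>UNIV. Nc V j l p * dx k (dy j f) p)
      + (\<Sum>j\<in>UNIV. \<Sum>i\<in>UNIV. Nc V j l p * (Nc V i k p * dy i (dy j f) p))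
      - (\<Sum>j\<in>UNIV. delta V k (Nc V j l) p * dy j f p)" for k l
  proof -
    have "delta V k (delta V l f) p = delta V k (dx l f) p
        - (\<Sum>j\<in>UNIV. Nc V j l p * delta V k (dy j f) p + delta V k (Nc V j l) p * dy j f p)"
      using assms by (subst delta_eq[of l]) (simp add: delta.diff delta.sum delta.mult)
    also have "delta V k (dx l f) p = dx k (dx l f) p - (\<Sum>i\<in>UNIV. Nc V i k p * dx l (dy i f) p)"
      using assms by (simp add: delta_def commute(3))
    also have "(\<Sum>j\<in>UNIV. Nc V j l p * delta V k (dy j f) p + delta V k (Nc V j l) p * dy j f p)
        = (\<Sum>j\<in>UNIV. Nc V j l p * dx k (dy j f) p)
        - (\<Sum>j\<in>UNIV. \<Sum>i\<in>UNIV. Nc V j l p * (Nc V i k p * dy i (dy j f) p))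
        + (\<Sum>j\<in>UNIV. delta V k (Nc V j l) p * dy j f p)"
      by (simp only: delta_def[of V k "dy _ f"] right_diff_distrib sum_distrib_left sum.distrib
          sum_subtractf)
    finally show ?thesis by simp
  qed
  have "(\<Sum>j\<in>UNIV. \<Sum>i\<in>UNIV. Nc V j l p * (Nc V i k p * dy i (dy j f) p))
      = (\<Sum>i\<in>UNIV. \<Sum>j\<in>UNIV. Nc V i k p * (Nc V j l p * dy j (dy i f) p))"
    using assms by (subst sum.swap) (intro sum.cong, auto simp: commute(2))
  then show ?thesis
    using commute(1)[OF assms(2,1), of k l] unfolding expand
    by (simp add: curv_def left_diff_distrib sum_subtractf)
qed

text \<open>Exchanging \<open>\<partial>/\<partial>y\<^sup>m\<close> with \<open>\<delta>\<^sub>k\<close> turns each summand into \<open>\<delta>\<^sub>k \<Gamma>\<^sup>i\<^sub>m\<^sub>l - \<Gamma>\<^sup>j\<^sub>m\<^sub>k \<Gamma>\<^sup>i\<^sub>j\<^sub>l\<close> minus the same with \<open>k\<close> and \<open>l\<close>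
  exchanged; the symmetry of \<open>\<Gamma>\<close> cancels the cyclic sum.\<close>

lemma vertical_bianchi:
  assumes "p \<in> S"
  shows "dy m (curv i k l) p + dy k (curv i l m) p + dy l (curv i m k) p = 0"
proof -
  have *: "dy m (delta V k (Nc V i l)) p = delta V k (berwald_conn V i m l) p
     - (\<Sum>j\<in>UNIV. berwald_conn V j m k p * berwald_conn V i j l p)" for k l m
    using assms by (simp add: dy_delta dy_Nc)
  have sym: "delta V k (berwald_conn V i m l) p = delta V k (berwald_conn V i l m) p"
    "berwald_conn V j m k p = berwald_conn V j k m p" for j k l m
    using assms conn_sym by (auto intro: delta.cong)
  show ?thesis
    using assms
    by (simp add: curv_def dy.diff * sym(1)[of _ k m] sym(1)[of _ m l] sym(1)[of _ l k]
       sym(2)[of _ k m] sym(2)[of _ m l] sym(2)[of _ l k])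
qed

text \<open>The Bianchi identity of the Berwald connection, with the symmetric \<open>\<Gamma>\<close>-terms on the
  lower indices already cancelled. The cyclic sum of second derivatives of \<open>N\<close> regroups into
  commutators \<open>[\<delta>\<^sub>m, \<delta>\<^sub>k] N\<^sup>i\<^sub>l\<close>, which are curvature terms.\<close>

lemma horizontal_bianchi:
  assumes "p \<in> S"
  shows "(delta V m (curv i k l) p + (\<Sum>j\<in>UNIV. berwald_conn V i j m p * curv j k l p))
    + (delta V k (curv i l m) p + (\<Sum>j\<in>UNIV. berwald_conn V i j k p * curv j l m p))
    + (delta V l (curv i m k) p + (\<Sum>j\<in>UNIV. berwald_conn V i j l p * curv j m k p)) = 0"
proof -
  have d: "delta V m (curv i k l) p = delta V m (delta V k (Nc V i l)) p - delta V m (delta V l (Nc V i k)) p"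
    for k l m
    using assms by (simp add: curv_def delta.diff)
  have c: "delta V k (delta V l (Nc V i m)) p - delta V l (delta V k (Nc V i m)) p
     = - (\<Sum>j\<in>UNIV. berwald_conn V i j m p * curv j k l p)" for k l m
    using delta_commutator[OF assms, of "Nc V i m" k l] by (simp add: dy_Nc mult.commute)
  show ?thesis
    using c[of m k l] c[of k l m] c[of l m k] by (simp add: d)
qed

section \<open>Homogeneity\<close>

text \<open>The Liouville field, acting on functions. A function \<open>f\<close> is homogeneous of degree \<open>d\<close> in
  \<open>y\<close> when \<open>euler f = d f\<close>.\<close>

definition euler :: "('n tpoint \<Rightarrow> real) \<Rightarrow> 'n tpoint \<Rightarrow> real" where
  "euler f p = (\<Sum>m\<in>UNIV. snd p $ m * dy m f p)"

sublocale euler: derivation S euler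
proof unfold_locales
  show "smooth_on S (euler f)" if "smooth_on S f" for f
    using that by (simp add: euler_def[abs_def])
  show "euler f p = euler g p" if "p \<in> S" "\<And>q. q \<in> S \<Longrightarrow> f q = g q" for p f g
    unfolding euler_def using dy.cong[OF that] by simp
  fix p and f g :: "'n tpoint \<Rightarrow> real" assume *: "p \<in> S" "smooth_on S f" "smooth_on S g"
  show "euler (\<lambda>q. f q + g q) p = euler f p + euler g p"
    using * by (simp add: euler_def dy.add algebra_simps sum.distrib)
  show "euler (\<lambda>q. f q * g q) p = f p * euler g p + euler f p * g p"
    using * by (simp add: euler_def dy.mult algebra_simps sum.distrib sum_distrib_left)
qed (simp_all add: euler_def dy.const)

lemma euler_y [simp]: "euler (\<lambda>q. snd q $ i) p = snd p $ i"
  by (simp add: euler_def dy_y if_distrib cong: if_cong)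

lemma euler_dy:
  assumes "p \<in> S" "smooth_on S f"
  shows "euler (dy k f) p = dy k (euler f) p - dy k f p"
proof -
  have "dy k (euler f) p = (\<Sum>m\<in>UNIV. snd p $ m * dy k (dy m f) p + (if k = m then 1 else 0) * dy m f p)"
    using assms by (simp add: euler_def[abs_def] dy.sum dy.mult dy_y)
  also have "\<dots> = euler (dy k f) p + dy k f p"
    using assms by (simp add: sum.distrib euler_def commute(2)[of f p k] if_distrib[of "\<lambda>c. c * _"] cong: if_cong)
  finally show ?thesis by simp
qed

lemma euler_Gc: "p \<in> S \<Longrightarrow> euler (Gc V i) p = 2 * Gc V i p"
  by (simp add: euler_def Gc_euler)

lemma euler_Nc: assumes "p \<in> S" shows "euler (Nc V i j) p = Nc V i j p"
proof -
  have "dy j (euler (Gc V i)) p = dy j (\<lambda>q. 2 * Gc V i q) p"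
    by (rule dy.cong[OF assms]) (simp add: euler_Gc)
  then show ?thesis
    using assms by (simp add: Nc_def euler_dy dy.scale)
qed

lemma sum_Nc_y: "p \<in> S \<Longrightarrow> (\<Sum>j\<in>UNIV. Nc V i j p * snd p $ j) = 2 * Gc V i p"
  using Gc_euler by (simp add: Nc_def mult.commute)

lemma sum_conn_y:
  assumes "p \<in> S"
  shows "(\<Sum>m\<in>UNIV. snd p $ m * berwald_conn V i m k p) = Nc V i k p"
    "(\<Sum>m\<in>UNIV. snd p $ m * berwald_conn V i k m p) = Nc V i k p"
  using euler_Nc[OF assms, of i k] assms by (simp_all add: euler_def dy_Nc conn_sym[of p i k])

text \<open>The horizontal fields are homogeneous of degree zero: the two contributions of \<open>N\<close>, from
  \<open>\<delta>\<^sub>k y\<^sup>m = - N\<^sup>m\<^sub>k\<close> and from the commutator contracted with \<open>y\<^sup>m\<close>, cancel.\<close>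

lemma euler_delta:
  assumes "p \<in> S" "smooth_on S f"
  shows "euler (delta V k f) p = delta V k (euler f) p"
proof -
  have "euler (delta V k f) p = (\<Sum>m\<in>UNIV. snd p $ m * delta V k (dy m f) p)
      - (\<Sum>m\<in>UNIV. \<Sum>j\<in>UNIV. snd p $ m * (berwald_conn V j m k p * dy j f p))"
    using assms by (simp add: euler_def dy_delta right_diff_distrib sum_subtractf sum_distrib_left)
  also have "(\<Sum>m\<in>UNIV. \<Sum>j\<in>UNIV. snd p $ m * (berwald_conn V j m k p * dy j f p))
      = (\<Sum>j\<in>UNIV. (\<Sum>m\<in>UNIV. snd p $ m * berwald_conn V j m k p) * dy j f p)"
    by (subst sum.swap) (simp add: sum_distrib_right mult.assoc)
  also have "\<dots> = (\<Sum>j\<in>UNIV. Nc V j k p * dy j f p)"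
    using assms by (simp add: sum_conn_y)
  also have "(\<Sum>m\<in>UNIV. snd p $ m * delta V k (dy m f) p) - (\<Sum>j\<in>UNIV. Nc V j k p * dy j f p)
      = delta V k (euler f) p"
    using assms by (simp add: euler_def[abs_def] delta.sum delta.mult delta_y sum_subtractf)
  finally show ?thesis .
qed

lemma euler_curv: assumes "p \<in> S" shows "euler (curv i k l) p = curv i k l p"
proof -
  have "delta V k (euler (Nc V i l)) p = delta V k (Nc V i l) p" for k l
    by (rule delta.cong[OF assms]) (simp add: euler_Nc)
  then show ?thesis
    using assms by (simp add: curv_def euler.diff euler_delta)
qed

text \<open>Contracting with \<open>y\<^sup>l\<close> replaces \<open>N\<^sup>i\<^sub>l\<close> by \<open>2G\<^sup>i\<close>, up to the correction from
  \<open>\<delta>\<^sub>k y\<^sup>l = - N\<^sup>l\<^sub>k\<close>; this reproduces the four terms of the definition of \<open>R\<^sup>i\<^sub>k\<close>.\<close>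

lemma Riem_eq_curv: assumes "p \<in> S" shows "Riem V i k p = (\<Sum>l\<in>UNIV. curv i k l p * snd p $ l)"
proof -
  have "delta V k (\<lambda>q. \<Sum>l\<in>UNIV. Nc V i l q * snd q $ l) p = delta V k (\<lambda>q. 2 * Gc V i q) p"
    by (rule delta.cong[OF assms]) (simp add: sum_Nc_y)
  then have "2 * delta V k (Gc V i) p
      = (\<Sum>l\<in>UNIV. snd p $ l * delta V k (Nc V i l) p) - (\<Sum>l\<in>UNIV. Nc V i l p * Nc V l k p)"
    using assms by (simp add: delta.sum delta.mult delta.const delta_y sum_subtractf mult.commute)
  moreover have "delta V k (Gc V i) p = dx k (Gc V i) p - (\<Sum>l\<in>UNIV. Nc V i l p * Nc V l k p)"
    by (simp add: delta_def Nc_def mult.commute)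
  moreover have "(\<Sum>l\<in>UNIV. snd p $ l * delta V l (Nc V i k) p)
      = (\<Sum>l\<in>UNIV. snd p $ l * dx l (Nc V i k) p) - 2 * (\<Sum>j\<in>UNIV. Gc V j p * dy j (Nc V i k) p)"
  proof -
    have "(\<Sum>l\<in>UNIV. \<Sum>j\<in>UNIV. snd p $ l * (Nc V j l p * dy j (Nc V i k) p))
        = (\<Sum>j\<in>UNIV. (\<Sum>l\<in>UNIV. Nc V j l p * snd p $ l) * dy j (Nc V i k) p)"
      by (subst sum.swap) (simp add: sum_distrib_left sum_distrib_right mult_ac)
    also have "\<dots> = 2 * (\<Sum>j\<in>UNIV. Gc V j p * dy j (Nc V i k) p)"
      using assms by (simp add: sum_Nc_y sum_distrib_left mult.assoc)
    finally show ?thesis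
      by (simp add: delta_def right_diff_distrib sum_subtractf sum_distrib_left)
  qed
  ultimately show ?thesis
    unfolding Riem_def
    by (simp add: curv_def Nc_def[symmetric] left_diff_distrib right_diff_distrib sum_subtractf mult.commute)
qed

lemma smooth_Riem: "smooth_on S (Riem V i k)"
  by (rule smooth_cong[where f = "\<lambda>p. \<Sum>l\<in>UNIV. curv i k l p * snd p $ l"])
     (simp_all add: Riem_eq_curv)

lemma Riem_y: assumes "p \<in> S" shows "(\<Sum>k\<in>UNIV. Riem V i k p * snd p $ k) = 0"
proof -
  let ?s = "\<Sum>k\<in>UNIV. \<Sum>l\<in>UNIV. curv i k l p * snd p $ l * snd p $ k"
  have flip: "curv i l k p * snd p $ k * snd p $ l = - (curv i k l p * snd p $ l * snd p $ k)" for k l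
    by (simp add: curv_antisym[of i l k])
  have "?s = (\<Sum>k\<in>UNIV. \<Sum>l\<in>UNIV. curv i l k p * snd p $ k * snd p $ l)"
    by (rule sum.swap)
  also have "\<dots> = (\<Sum>k\<in>UNIV. \<Sum>l\<in>UNIV. - (curv i k l p * snd p $ l * snd p $ k))"
    by (intro sum.cong refl flip)
  also have "\<dots> = - ?s"
    by (simp only: sum_negf)
  finally show ?thesis
    using assms by (simp add: Riem_eq_curv sum_distrib_right)
qed

lemma euler_Riem: assumes "p \<in> S" shows "euler (Riem V i k) p = 2 * Riem V i k p"
proof -
  have "euler (Riem V i k) p = euler (\<lambda>q. \<Sum>l\<in>UNIV. curv i k l q * snd q $ l) p"
    by (rule euler.cong[OF assms]) (simp add: Riem_eq_curv)
  also have "\<dots> = 2 * Riem V i k p"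
    using assms by (simp add: euler.sum euler.mult euler_curv Riem_eq_curv sum_distrib_left mult_ac)
  finally show ?thesis .
qed

text \<open>The Riemann curvature determines the full curvature. Differentiating \<open>R\<^sup>i\<^sub>k = R\<^sup>i\<^sub>k\<^sub>m y\<^sup>m\<close> and
  antisymmetrising gives \<open>2 R\<^sup>i\<^sub>k\<^sub>l\<close> from the factors \<open>y\<^sup>m\<close>; by the vertical Bianchi identity the
  remaining terms combine to the Euler derivative of \<open>R\<^sup>i\<^sub>k\<^sub>l\<close>, which is the third copy.\<close>

lemma curv_eq_Riem:
  assumes "p \<in> S"
  shows "3 * curv i k l p = dy l (Riem V i k) p - dy k (Riem V i l) p"
proof -
  have d: "dy l (Riem V i k) p = curv i k l p + (\<Sum>m\<in>UNIV. snd p $ m * dy l (curv i k m) p)" for k l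
  proof -
    have "dy l (Riem V i k) p = dy l (\<lambda>q. \<Sum>m\<in>UNIV. curv i k m q * snd q $ m) p"
      by (rule dy.cong[OF assms]) (simp add: Riem_eq_curv)
    also have "\<dots> = curv i k l p + (\<Sum>m\<in>UNIV. snd p $ m * dy l (curv i k m) p)"
      using assms by (simp add: dy.sum dy.mult dy_y sum.distrib if_distrib[of "\<lambda>c. _ * c"]
          mult.commute[of _ "snd p $ _"] cong: if_cong)
    finally show ?thesis .
  qed
  have "dy l (curv i k m) p - dy k (curv i l m) p = dy m (curv i k l) p" for m
    using vertical_bianchi[OF assms, of m i k l] curv_antisym[of i k m] assms
    by (simp add: dy.minus)
  then have "(\<Sum>m\<in>UNIV. snd p $ m * dy l (curv i k m) p) - (\<Sum>m\<in>UNIV. snd p $ m * dy k (curv i l m) p)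
      = euler (curv i k l) p"
    by (simp add: euler_def right_diff_distrib[symmetric] sum_subtractf[symmetric])
  moreover have "curv i l k p = - curv i k l p"
    by (simp add: curv_def)
  ultimately show ?thesis
    using euler_curv[OF assms, of i k l] unfolding d by linarith
qed

end

section \<open>Sprays of scalar curvature\<close>

lemma sum_kronecker:
  fixes f :: "'i::finite \<Rightarrow> real"
  shows "(\<Sum>k\<in>UNIV. f k * (if i = k then 1 else 0)) = f i"
    "(\<Sum>k\<in>UNIV. f k * (if k = i then 1 else 0)) = f i"
  by (simp_all add: if_distrib[of "\<lambda>c. _ * c"] cong: if_cong)

text \<open>The factor in front of \<open>\<delta>\<^sup>i\<^sub>k\<close> is forced to be the Ricci scalar: \<open>R\<^sup>i\<^sub>k y\<^sup>k = 0\<close> and \<open>y \<noteq> 0\<close>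
  give \<open>\<tau>\<^sub>k y\<^sup>k = r\<close>, and then the trace is \<open>(n - 1) r\<close>.\<close>

lemma (in local_spray) scalar_curvature_factor:
  assumes p: "p \<in> S" and n: "CARD('n) \<ge> 2"
    and iso: "\<And>i k. Riem V i k p = r * (if i = k then 1 else 0) - t k * snd p $ i"
  shows "(\<Sum>k\<in>UNIV. t k * snd p $ k) = r" "ricci_scalar V p = r"
proof -
  obtain i where i: "snd p $ i \<noteq> 0"
    using y_nonzero[OF p] by (metis vec_eq_iff zero_index)
  have "(\<Sum>k\<in>UNIV. Riem V i k p * snd p $ k) = r * snd p $ i - (\<Sum>k\<in>UNIV. t k * snd p $ k) * snd p $ i"
  proof -
    have "Riem V i k p * snd p $ k = r * snd p $ k * (if i = k then 1 else 0)
        - t k * snd p $ k * snd p $ i" for k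
      by (simp add: iso algebra_simps)
    then show ?thesis
      by (simp only: sum_subtractf sum_kronecker sum_distrib_right[symmetric])
  qed
  with i show t: "(\<Sum>k\<in>UNIV. t k * snd p $ k) = r"
    using Riem_y[OF p, of i] by (simp add: left_diff_distrib[symmetric])
  have "Ric V p = real CARD('n) * r - r"
    by (simp add: Ric_def iso sum_subtractf t)
  then show "ricci_scalar V p = r"
    using n by (simp add: ricci_scalar_def field_simps)
qed

locale scalar_spray = local_spray S V
  for S :: "'n::finite tpoint set" and V +
  fixes \<tau> :: "'n \<Rightarrow> 'n tpoint \<Rightarrow> real"
  assumes Riem_scalar: "p \<in> S \<Longrightarrow>
      Riem V i k p = ricci_scalar V p * (if i = k then 1 else 0) - \<tau> k p * snd p $ i"
    and card_ge_2: "CARD('n) \<ge> 2"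
begin

abbreviation R where "R \<equiv> ricci_scalar V"

lemma tau_y: "p \<in> S \<Longrightarrow> (\<Sum>k\<in>UNIV. \<tau> k p * snd p $ k) = R p"
  using scalar_curvature_factor(1)[OF _ card_ge_2 Riem_scalar] .

lemma smooth_R [simp]: "smooth_on S R"
  unfolding ricci_scalar_def[abs_def] Ric_def
  by (intro smooth_mult smooth_const smooth_sum smooth_Riem)

text \<open>Contracting \<open>R\<^sup>i\<^sub>k = R \<delta>\<^sup>i\<^sub>k - \<tau>\<^sub>k y\<^sup>i\<close> with \<open>y\<^sup>i\<close> and dividing by \<open>\<Sum>\<^sub>i (y\<^sup>i)\<^sup>2\<close> expresses \<open>\<tau>\<^sub>k\<close> through
  smooth functions.\<close>

lemma smooth_tau [simp]: "smooth_on S (\<tau> k)"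
proof -
  have pos: "(\<Sum>i\<in>UNIV. snd p $ i * snd p $ i) \<noteq> 0" if "p \<in> S" for p
  proof
    assume "(\<Sum>i\<in>UNIV. snd p $ i * snd p $ i) = 0"
    then have "\<forall>i. snd p $ i = 0"
      by (subst (asm) sum_nonneg_eq_0_iff) auto
    then show False
      using y_nonzero[OF that] by (simp add: vec_eq_iff)
  qed
  show ?thesis
  proof (rule smooth_cong)
    show "smooth_on S (\<lambda>p. (R p * snd p $ k - (\<Sum>i\<in>UNIV. Riem V i k p * snd p $ i))
        * inverse (\<Sum>i\<in>UNIV. snd p $ i * snd p $ i))"
      by (intro smooth_mult smooth_diff smooth_sum smooth_inverse smooth_R smooth_y smooth_Riem pos)
    fix p assume p: "p \<in> S"
    have "(\<Sum>i\<in>UNIV. Riem V i k p * snd p $ i)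
        = R p * snd p $ k - \<tau> k p * (\<Sum>i\<in>UNIV. snd p $ i * snd p $ i)"
    proof -
      have "Riem V i k p * snd p $ i = R p * snd p $ i * (if i = k then 1 else 0)
          - \<tau> k p * (snd p $ i * snd p $ i)" for i
        using p by (simp add: Riem_scalar algebra_simps)
      then show ?thesis
        by (simp only: sum_subtractf sum_kronecker sum_distrib_left[symmetric])
    qed
    then show "(R p * snd p $ k - (\<Sum>i\<in>UNIV. Riem V i k p * snd p $ i))
        * inverse (\<Sum>i\<in>UNIV. snd p $ i * snd p $ i) = \<tau> k p"
      using pos[OF p] by simp
  qed
qed

lemma euler_R: assumes "p \<in> S" shows "euler R p = 2 * R p"
  unfolding ricci_scalar_def[abs_def] Ric_def
  using assms by (subst euler.scale)
    (simp_all add: euler.sum smooth_Riem euler_Riem sum_distrib_left[symmetric])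

text \<open>Both \<open>R\<close> and \<open>R\<^sup>i\<^sub>k\<close> have degree two, so \<open>\<tau>\<^sub>k y\<^sup>i\<close> has degree two; a nonzero component \<open>y\<^sup>i\<close>
  can be cancelled.\<close>

lemma euler_tau: assumes "p \<in> S" shows "euler (\<tau> k) p = \<tau> k p"
proof -
  obtain i where i: "snd p $ i \<noteq> 0"
    using y_nonzero[OF assms] by (metis vec_eq_iff zero_index)
  have "euler (Riem V i k) p = euler (\<lambda>q. R q * (if i = k then 1 else 0) - \<tau> k q * snd q $ i) p"
    by (rule euler.cong[OF assms]) (simp add: Riem_scalar)
  then have "2 * Riem V i k p = 2 * R p * (if i = k then 1 else 0)
      - (\<tau> k p * snd p $ i + euler (\<tau> k) p * snd p $ i)"
    using assms by (simp add: euler_Riem euler.diff euler.mult euler.const euler_R)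
  with i show ?thesis
    using assms by (simp add: Riem_scalar algebra_simps split: if_splits)
qed

lemma curv_scalar:
  assumes "p \<in> S"
  shows "3 * curv i k l p = (dy l R p + \<tau> l p) * (if i = k then 1 else 0)
    - (dy k R p + \<tau> k p) * (if i = l then 1 else 0)
    + (dy k (\<tau> l) p - dy l (\<tau> k) p) * snd p $ i"
proof -
  have d: "dy l (Riem V i k) p = dy l R p * (if i = k then 1 else 0)
      - (\<tau> k p * (if i = l then 1 else 0) + dy l (\<tau> k) p * snd p $ i)" for k l
  proof -
    have "dy l (Riem V i k) p = dy l (\<lambda>q. R q * (if i = k then 1 else 0) - \<tau> k q * snd q $ i) p"
      by (rule dy.cong[OF assms]) (simp add: Riem_scalar)
    then show ?thesis
      using assms by (simp add: dy.diff dy.mult dy.const dy_y)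
  qed
  show ?thesis
    unfolding curv_eq_Riem[OF assms] d by (simp add: algebra_simps)
qed

end

section \<open>Sprays whose mean connection is closed\<close>

text \<open>The trace \<open>\<Gamma>\<^sup>m\<^sub>m\<^sub>l\<close> of the Berwald connection is a closed one-form \<open>s\<close> pulled back from the
  base. With \<open>s = d (ln \<sigma>)\<close> this holds for the projective spray attached to a volume form.\<close>

locale closed_scalar_spray = scalar_spray S V \<tau>
  for S :: "'n::finite tpoint set" and V \<tau> +
  fixes s :: "'n \<Rightarrow> 'n tpoint \<Rightarrow> real"
  assumes smooth_s [simp]: "smooth_on S (s k)"
    and s_closed: "p \<in> S \<Longrightarrow> dx k (s l) p = dx l (s k) p"
    and s_vertical: "p \<in> S \<Longrightarrow> dy k (s l) p = 0"
    and trace_Nc: "p \<in> S \<Longrightarrow> (\<Sum>m\<in>UNIV. Nc V m m p) = (\<Sum>m\<in>UNIV. snd p $ m * s m p)"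
    and card_ge_3: "CARD('n) \<ge> 3"
begin

lemma trace_conn: assumes "p \<in> S" shows "(\<Sum>m\<in>UNIV. berwald_conn V m m l p) = s l p"
proof -
  have "(\<Sum>m\<in>UNIV. berwald_conn V m m l p) = (\<Sum>m\<in>UNIV. dy l (Nc V m m) p)"
    using assms by (simp add: dy_Nc conn_sym)
  also have "\<dots> = dy l (\<lambda>q. \<Sum>m\<in>UNIV. Nc V m m q) p"
    using assms by (simp add: dy.sum)
  also have "\<dots> = dy l (\<lambda>q. \<Sum>m\<in>UNIV. snd q $ m * s m q) p"
    by (rule dy.cong[OF assms]) (rule trace_Nc)
  also have "\<dots> = s l p"
    using assms by (simp add: dy.sum dy.mult dy_y s_vertical if_distrib[of "\<lambda>c. c * _"] cong: if_cong)
  finally show ?thesis .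
qed

text \<open>Up to sign the divergence is the trace \<open>R\<^sub>m\<^sup>m\<^sub>k\<^sub>l\<close> of the Berwald curvature, hence the
  curvature \<open>ds\<close> of the induced connection on densities, which vanishes.\<close>

lemma divergence_curv:
  assumes "p \<in> S"
  shows "(\<Sum>m\<in>UNIV. dy m (curv m k l) p) = 0"
proof -
  have 1: "(\<Sum>m\<in>UNIV. dy m (delta V k (Nc V m l)) p)
      = dx k (s l) p - (\<Sum>m\<in>UNIV. \<Sum>j\<in>UNIV. berwald_conn V j m k p * berwald_conn V m j l p)" for k l
  proof -
    have "(\<Sum>m\<in>UNIV. delta V k (berwald_conn V m m l) p) = delta V k (\<lambda>q. \<Sum>m\<in>UNIV. berwald_conn V m m l q) p"
      using assms by (simp add: delta.sum)
    also have "\<dots> = delta V k (s l) p"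
      by (rule delta.cong[OF assms]) (rule trace_conn)
    also have "\<dots> = dx k (s l) p"
      using assms by (simp add: delta_def s_vertical)
    finally show ?thesis
      using assms by (simp add: dy_delta dy_Nc sum_subtractf)
  qed
  have "(\<Sum>m\<in>UNIV. \<Sum>j\<in>UNIV. berwald_conn V j m k p * berwald_conn V m j l p)
      = (\<Sum>m\<in>UNIV. \<Sum>j\<in>UNIV. berwald_conn V j m l p * berwald_conn V m j k p)"
    by (subst sum.swap) (simp add: mult.commute)
  then show ?thesis
    using assms s_closed[OF assms, of k l] by (simp add: curv_def dy.diff sum_subtractf 1)
qed

text \<open>In the divergence of the formula for \<open>3 R\<^sup>i\<^sub>k\<^sub>l\<close> the terms with \<open>\<delta>\<^sup>i\<^sub>k\<close> contribute one copy of
  \<open>b = \<partial>\<^sub>k \<tau>\<^sub>l - \<partial>\<^sub>l \<tau>\<^sub>k\<close>, and the term \<open>b y\<^sup>i\<close> contributes \<open>n b\<close>, as \<open>b\<close> has degree zero. So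
  \<open>(n + 1) b = 0\<close>.\<close>

lemma dy_tau_sym: assumes "p \<in> S" shows "dy k (\<tau> l) p = dy l (\<tau> k) p"
proof -
  define a where "a = (\<lambda>l q. dy l R q + \<tau> l q)"
  define b where "b = (\<lambda>q. dy k (\<tau> l) q - dy l (\<tau> k) q)"
  have smooth_ab [simp]: "smooth_on S (a l)" "smooth_on S b" for l
    by (simp_all add: a_def b_def)
  have "3 * dy m (curv m k l) p = dy m (a l) p * (if m = k then 1 else 0)
      - dy m (a k) p * (if m = l then 1 else 0) + (b p + dy m b p * snd p $ m)" for m
  proof -
    have "dy m (\<lambda>q. 3 * curv m k l q) p = dy m (\<lambda>q. a l q * (if m = k then 1 else 0)
      - a k q * (if m = l then 1 else 0) + b q * snd q $ m) p"
      by (rule dy.cong[OF assms]) (simp only: a_def b_def curv_scalar)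
    then show ?thesis
      using assms by (simp add: dy.add dy.diff dy.mult dy.const dy_y)
  qed
  then have "3 * (\<Sum>m\<in>UNIV. dy m (curv m k l) p)
      = dy k (a l) p - dy l (a k) p + (real CARD('n) * b p + euler b p)"
    by (simp add: sum_distrib_left sum.distrib sum_subtractf euler_def mult.commute
        if_distrib[of "\<lambda>c. _ * c"] cong: if_cong)
  moreover have "dy k (a l) p - dy l (a k) p = b p"
    using assms by (simp add: a_def b_def dy.add commute(2)[of R p k])
  moreover have "euler b p = 0"
  proof -
    have "dy k (euler (\<tau> l)) p = dy k (\<tau> l) p" for k l
      by (rule dy.cong[OF assms]) (rule euler_tau)
    then show ?thesis
      using assms by (simp add: b_def euler.diff euler_dy)
  qed
  ultimately have "(real CARD('n) + 1) * b p = 0"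
    using divergence_curv[OF assms] by (simp add: algebra_simps)
  then have "b p = 0"
    by (metis add_nonneg_pos less_irrefl mult_eq_0_iff of_nat_0_le_iff zero_less_one)
  then show ?thesis
    by (simp add: b_def)
qed

text \<open>\<open>R = \<tau>\<^sub>l y\<^sup>l\<close>; by the symmetry of \<open>\<partial>\<^sub>k \<tau>\<^sub>l\<close>, differentiating \<open>\<tau>\<^sub>l\<close> gives the Euler derivative of
  \<open>\<tau>\<^sub>k\<close>, a second copy of \<open>\<tau>\<^sub>k\<close>.\<close>

lemma dy_R: assumes "p \<in> S" shows "dy k R p = 2 * \<tau> k p"
proof -
  have "dy k R p = dy k (\<lambda>q. \<Sum>l\<in>UNIV. \<tau> l q * snd q $ l) p"
    by (rule dy.cong[OF assms]) (simp add: tau_y)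
  also have "\<dots> = \<tau> k p + (\<Sum>l\<in>UNIV. dy k (\<tau> l) p * snd p $ l)"
    using assms by (simp add: dy.sum dy.mult dy_y sum.distrib if_distrib[of "\<lambda>c. _ * c"] cong: if_cong)
  also have "(\<Sum>l\<in>UNIV. dy k (\<tau> l) p * snd p $ l) = euler (\<tau> k) p"
    unfolding euler_def by (intro sum.cong) (simp_all add: dy_tau_sym[OF assms, of k])
  finally show ?thesis
    using euler_tau[OF assms] by simp
qed

lemma curv_eq_tau:
  assumes "p \<in> S"
  shows "curv i k l p = \<tau> l p * (if i = k then 1 else 0) - \<tau> k p * (if i = l then 1 else 0)"
  using curv_scalar[OF assms, of i k l] dy_tau_sym[OF assms, of k l] dy_R[OF assms]
  by (simp split: if_splits)

text \<open>This is where three dimensions are used: for \<open>k\<close> different from \<open>l\<close> and \<open>m\<close>, the component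
  \<open>i = k\<close> of the Bianchi identity contains \<open>\<delta>\<^sub>m \<tau>\<^sub>l - \<delta>\<^sub>l \<tau>\<^sub>m\<close> and nothing else. By the symmetry of \<open>\<Gamma>\<close>
  this is equivalent to the symmetry of the covariant derivative of \<open>\<tau>\<close>.\<close>

lemma delta_tau_sym: assumes "p \<in> S" shows "delta V m (\<tau> l) p = delta V l (\<tau> m) p"
proof (cases "l = m")
  case False
  have "\<not> UNIV \<subseteq> {l, m}"
    using card_mono[of "{l, m}" UNIV] card_ge_3 False by auto
  then obtain k where k: "k \<noteq> l" "k \<noteq> m"
    by auto
  have d: "delta V m (curv i k l) p = delta V m (\<tau> l) p * (if i = k then 1 else 0)
      - delta V m (\<tau> k) p * (if i = l then 1 else 0)" for i k l m
  proof -
    have "delta V m (curv i k l) p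
        = delta V m (\<lambda>q. \<tau> l q * (if i = k then 1 else 0) - \<tau> k q * (if i = l then 1 else 0)) p"
      by (rule delta.cong[OF assms]) (rule curv_eq_tau)
    then show ?thesis
      using assms by (simp add: delta.diff delta.mult delta.const)
  qed
  have g: "(\<Sum>j\<in>UNIV. berwald_conn V i j m p * curv j k l p)
      = berwald_conn V i k m p * \<tau> l p - berwald_conn V i l m p * \<tau> k p" for i k l m
    using assms by (simp add: curv_eq_tau right_diff_distrib sum_subtractf
        if_distrib[of "\<lambda>c. _ * c"] cong: if_cong)
  show ?thesis
    using horizontal_bianchi[OF assms, of m k k l] k False
      conn_sym[OF assms, of k k m] conn_sym[OF assms, of k k l] conn_sym[OF assms, of k l m]
    by (simp add: d g)
qed simp

text \<open>As \<open>\<partial>\<^sub>k R = 2 \<tau>\<^sub>k\<close>, the subtracted term is \<open>\<tau>\<^sub>k\<^sub>|\<^sub>m y\<^sup>m = \<tau>\<^sub>m\<^sub>|\<^sub>k y\<^sup>m\<close>. Since \<open>y\<close> is horizontally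
  constant, this is the horizontal derivative of \<open>\<tau>\<^sub>m y\<^sup>m = R\<close>.\<close>

theorem berwald_weyl_expression_vanishes:
  assumes "p \<in> S"
  shows "hcov_fun V R k p
    - 1 / 2 * (\<Sum>m\<in>UNIV. hcov_covec V (\<lambda>j. dy j R) k m p * snd p $ m) = 0"
proof -
  have R: "hcov_fun V R k p
      = (\<Sum>m\<in>UNIV. snd p $ m * delta V k (\<tau> m) p) - (\<Sum>m\<in>UNIV. Nc V m k p * \<tau> m p)"
  proof -
    have "delta V k R p = delta V k (\<lambda>q. \<Sum>m\<in>UNIV. snd q $ m * \<tau> m q) p"
      by (rule delta.cong[OF assms]) (simp add: tau_y[symmetric] mult.commute)
    then show ?thesis
      using assms by (simp add: hcov_fun_def delta.sum delta.mult delta_y sum_subtractf)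
  qed
  have "hcov_covec V (\<lambda>j. dy j R) k m p
      = 2 * delta V k (\<tau> m) p - 2 * (\<Sum>l\<in>UNIV. berwald_conn V l k m p * \<tau> l p)" for m
  proof -
    have "delta V m (dy k R) p = delta V m (\<lambda>q. 2 * \<tau> k q) p"
      by (rule delta.cong[OF assms]) (rule dy_R)
    also have "\<dots> = 2 * delta V k (\<tau> m) p"
      using assms delta_tau_sym[of p m k] by (simp add: delta.mult delta.const)
    finally show ?thesis
      using assms by (simp add: hcov_covec_def dy_R sum_distrib_left mult_ac)
  qed
  then have "(\<Sum>m\<in>UNIV. hcov_covec V (\<lambda>j. dy j R) k m p * snd p $ m)
      = 2 * (\<Sum>m\<in>UNIV. snd p $ m * delta V k (\<tau> m) p)
      - 2 * (\<Sum>m\<in>UNIV. \<Sum>l\<in>UNIV. snd p $ m * berwald_conn V l k m p * \<tau> l p)"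
    by (simp add: left_diff_distrib right_diff_distrib sum_subtractf sum_distrib_left
        sum_distrib_right mult_ac)
  also have "(\<Sum>m\<in>UNIV. \<Sum>l\<in>UNIV. snd p $ m * berwald_conn V l k m p * \<tau> l p)
      = (\<Sum>l\<in>UNIV. (\<Sum>m\<in>UNIV. snd p $ m * berwald_conn V l k m p) * \<tau> l p)"
    by (subst sum.swap) (simp add: sum_distrib_right)
  also have "\<dots> = (\<Sum>l\<in>UNIV. Nc V l k p * \<tau> l p)"
    using assms by (simp add: sum_conn_y)
  finally show ?thesis
    by (simp add: R)
qed

end

section \<open>Projective changes\<close>

locale projective_change = old: local_spray S V
  for S :: "'n::finite tpoint set" and V +
  fixes H :: "'n tpoint \<Rightarrow> 'n tpoint" and P :: "'n tpoint \<Rightarrow> real"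
  assumes smooth_P [simp]: "smooth_on S P"
    and euler_P: "p \<in> S \<Longrightarrow> old.euler P p = P p"
    and Gc_H: "p \<in> S \<Longrightarrow> Gc H i p = Gc V i p + P p * snd p $ i"
begin

sublocale new: local_spray S H
proof unfold_locales
  show "smooth_on S (Gc H i)" for i
    by (rule old.smooth_cong[of "\<lambda>p. Gc V i p + P p * snd p $ i"]) (simp_all add: Gc_H)
  fix p i assume p: "p \<in> S"
  have "old.euler (Gc H i) p = old.euler (\<lambda>q. Gc V i q + P q * snd q $ i) p"
    by (rule old.euler.cong[OF p]) (rule Gc_H)
  also have "\<dots> = 2 * Gc H i p"
    using p by (simp add: old.euler.add old.euler.mult old.euler_Gc euler_P Gc_H)
  finally show "(\<Sum>m\<in>UNIV. snd p $ m * dy m (Gc H i) p) = 2 * Gc H i p"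
    by (simp add: old.euler_def)
qed (rule old.y_nonzero)

lemma Nc_H:
  assumes "p \<in> S"
  shows "Nc H i j p = Nc V i j p + dy j P p * snd p $ i + P p * (if i = j then 1 else 0)"
proof -
  have "dy j (Gc H i) p = dy j (\<lambda>q. Gc V i q + P q * snd q $ i) p"
    by (rule old.dy.cong[OF assms]) (rule Gc_H)
  then show ?thesis
    using assms by (simp add: Nc_def old.dy.add old.dy.mult old.dy_y)
qed

lemma delta_H:
  assumes "p \<in> S"
  shows "delta H k f p = delta V k f p - dy k P p * old.euler f p - P p * dy k f p"
proof -
  have "Nc H l k p * dy l f p = Nc V l k p * dy l f p + dy k P p * (snd p $ l * dy l f p)
      + P p * dy l f p * (if l = k then 1 else 0)" for l
    using assms by (simp add: Nc_H algebra_simps)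
  then have "(\<Sum>l\<in>UNIV. Nc H l k p * dy l f p)
      = (\<Sum>l\<in>UNIV. Nc V l k p * dy l f p) + dy k P p * old.euler f p + P p * dy k f p"
    by (simp only: sum.distrib sum_kronecker sum_distrib_left[symmetric] old.euler_def)
  then show ?thesis
    by (simp add: delta_def)
qed

text \<open>With \<open>P\<^sub>k = \<partial>\<^sub>k P\<close>, all terms that \<open>P\<close> adds to \<open>\<delta>\<^sub>k N\<^sup>i\<^sub>l\<close> are symmetric in \<open>k\<close> and \<open>l\<close> except for
  a multiple of \<open>y\<^sup>i\<close> and the multiples of \<open>\<delta>\<^sup>i\<^sub>k\<close> and \<open>\<delta>\<^sup>i\<^sub>l\<close>.\<close>

lemma curv_H:
  assumes "p \<in> S"
  shows "new.curv i k l p = old.curv i k l p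
    + (delta V k (dy l P) p - delta V l (dy k P) p) * snd p $ i
    + (delta V k P p - P p * dy k P p) * (if i = l then 1 else 0)
    - (delta V l P p - P p * dy l P p) * (if i = k then 1 else 0)"
proof -
  have euler_dyP: "old.euler (dy l P) p = 0" for l
  proof -
    have "dy l (old.euler P) p = dy l P p"
      by (rule old.dy.cong[OF assms]) (rule euler_P)
    then show ?thesis
      using assms by (simp add: old.euler_dy)
  qed
  have d: "delta H k (Nc H i l) p
      = delta V k (Nc V i l) p + delta V k (dy l P) p * snd p $ i
        + (delta V k P p - P p * dy k P p) * (if i = l then 1 else 0)
        - (dy l P p * Nc V i k p + dy k P p * Nc V i l p)
        - dy k P p * dy l P p * snd p $ i
        - P p * (berwald_conn V i k l p + dy k (dy l P) p * snd p $ i)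
        - P p * (dy l P p * (if i = k then 1 else 0) + dy k P p * (if i = l then 1 else 0))" for k l
  proof -
    have e: "delta H k (Nc H i l) p
        = delta H k (\<lambda>q. Nc V i l q + dy l P q * snd q $ i + P q * (if i = l then 1 else 0)) p"
      by (rule new.delta.cong[OF assms]) (rule Nc_H)
    show ?thesis
      unfolding e unfolding delta_H[OF assms] using assms
      by (simp add: old.delta.add old.delta.mult old.delta.const old.delta_y
          old.euler.add old.euler.mult old.euler.const old.euler_Nc euler_dyP euler_P
          old.dy.add old.dy.mult old.dy.const old.dy_y old.dy_Nc algebra_simps)
  qed
  show ?thesis
    unfolding new.curv_def old.curv_def d
    using assms by (simp add: old.conn_sym[of p i k l] old.commute(2)[of P p k l] algebra_simps)
qed

lemma Riem_H:
  assumes "p \<in> S"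
  shows "Riem H i k p = Riem V i k p
    + ((\<Sum>l\<in>UNIV. (delta V k (dy l P) p - delta V l (dy k P) p) * snd p $ l)
        + (delta V k P p - P p * dy k P p)) * snd p $ i
    - (\<Sum>l\<in>UNIV. (delta V l P p - P p * dy l P p) * snd p $ l) * (if i = k then 1 else 0)"
proof -
  have "Riem H i k p = (\<Sum>l\<in>UNIV. old.curv i k l p * snd p $ l
      + (delta V k (dy l P) p - delta V l (dy k P) p) * snd p $ l * snd p $ i
      + (delta V k P p - P p * dy k P p) * ((if i = l then 1 else 0) * snd p $ l)
      - (delta V l P p - P p * dy l P p) * snd p $ l * (if i = k then 1 else 0))"
    using assms by (simp add: new.Riem_eq_curv curv_H algebra_simps)
  then show ?thesis
    using assms by (simp add: old.Riem_eq_curv sum.distrib sum_subtractf sum_distrib_left[symmetric]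
        sum_distrib_right[symmetric] distrib_right if_distrib[of "\<lambda>c. c * _"] cong: if_cong)
qed

text \<open>The change of the Riemann curvature is itself a multiple of \<open>\<delta>\<^sup>i\<^sub>k\<close> plus a covector times
  \<open>y\<^sup>i\<close>, so it is absorbed by the Ricci scalar and \<open>\<tau>\<close>.\<close>

lemma scalar_spray_H:
  assumes "scalar_spray S V \<tau>"
  shows "scalar_spray S H (\<lambda>k p. \<tau> k p
    - (\<Sum>l\<in>UNIV. (delta V k (dy l P) p - delta V l (dy k P) p) * snd p $ l)
    - (delta V k P p - P p * dy k P p))" (is "scalar_spray S H ?\<tau>")
proof -
  interpret scalar_spray S V \<tau> by fact
  have "Riem H i k p = ricci_scalar H p * (if i = k then 1 else 0) - ?\<tau> k p * snd p $ i"
    if p: "p \<in> S" for p i k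
  proof -
    let ?r = "ricci_scalar V p - (\<Sum>l\<in>UNIV. (delta V l P p - P p * dy l P p) * snd p $ l)"
    have *: "Riem H i k p = ?r * (if i = k then 1 else 0) - ?\<tau> k p * snd p $ i" for i k
      unfolding Riem_H[OF p] Riem_scalar[OF p] by (simp add: algebra_simps)
    show ?thesis
      using * new.scalar_curvature_factor(2)[OF p card_ge_2 *] by simp
  qed
  then show ?thesis
    by unfold_locales (use card_ge_2 in auto)
qed

end

section \<open>Vanishing of the Berwald-Weyl curvature\<close>

lemma open_slit: "is_chart X c \<Longrightarrow> open (slit c)"
  by (auto simp: is_chart_def slit_def intro!: open_Times)

text \<open>Euler's equation is the derivative of \<open>G\<^sup>i(x, r y) = r\<^sup>2 G\<^sup>i(x, y)\<close> at \<open>r = 1\<close>.\<close>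

lemma spray_local:
  assumes "smooth_manifold X A" "spray A G" "c \<in> A"
  shows "local_spray (slit c) (G c)"
proof -
  have op: "open (slit c)"
    using assms by (intro open_slit[of X]) (auto simp: smooth_manifold_def)
  interpret open_region "slit c"
    by unfold_locales (rule op)
  have smooth: "smooth_on (slit c) (Gc (G c) i)" for i
  proof -
    have L: "bounded_linear (\<lambda>z :: 'b tpoint. (- (1 / 2) *\<^sub>R snd z) $ i)"
      by (intro bounded_linear_compose[OF bounded_linear_vec_nth]
          bounded_linear_compose[OF bounded_linear_scaleR_right] bounded_linear_snd)
    have "smooth_on (slit c) (G c)"
      using assms by (simp add: spray_def slit_vector_field_def)
    then show ?thesis
      unfolding Gc_def[abs_def] spray_coeff_def smooth_on_def
      using Ck_on_linear_comp[OF op L] by blast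
  qed
  show ?thesis
  proof unfold_locales
    show "smooth_on (slit c) (Gc (G c) i)" for i by (rule smooth)
    show "snd p \<noteq> 0" if "p \<in> slit c" for p
      using that by (auto simp: slit_def)
    fix p i assume p: "p \<in> slit c"
    obtain x y where xy: "p = (x, y)" by (cases p)
    let ?g = "Gc (G c) i"
    have diff: "(?g has_derivative frechet_derivative ?g (at p)) (at p)"
      using smooth_differentiable[OF smooth p] frechet_derivative_works by blast
    have "((\<lambda>r. (x, r *\<^sub>R y)) has_derivative (\<lambda>h. (0, h *\<^sub>R y))) (at 1)"
      by (auto intro!: derivative_eq_intros)
    then have 1: "((\<lambda>r. ?g (x, r *\<^sub>R y)) has_derivative (\<lambda>h. frechet_derivative ?g (at p) (0, h *\<^sub>R y))) (at 1)"
      by (rule has_derivative_compose) (use diff xy in simp)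
    have "((\<lambda>r. r\<^sup>2 * ?g p) has_derivative (\<lambda>h. 2 * h * ?g p)) (at 1)"
      by (auto intro!: derivative_eq_intros)
    then have 2: "((\<lambda>r. ?g (x, r *\<^sub>R y)) has_derivative (\<lambda>h. 2 * h * ?g p)) (at 1)"
    proof (rule has_derivative_transform_within_open[of _ _ _ _ "{0<..}"])
      fix r :: real assume "r \<in> {0<..}"
      moreover have "case p of (x, y) \<Rightarrow> fst (G c (x, y)) = y \<and>
          (\<forall>r>0. spray_coeff (G c) (x, r *\<^sub>R y) = r\<^sup>2 *\<^sub>R spray_coeff (G c) (x, y))"
        using assms(2,3) p unfolding spray_def by blast
      ultimately have "spray_coeff (G c) (x, r *\<^sub>R y) = r\<^sup>2 *\<^sub>R spray_coeff (G c) (x, y)"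
        by (simp add: xy)
      then show "r\<^sup>2 * ?g p = ?g (x, r *\<^sub>R y)"
        by (simp add: Gc_def xy)
    qed auto
    have "2 * ?g p = frechet_derivative ?g (at p) (0, y)"
      using fun_cong[OF has_derivative_unique[OF 1 2], of 1] by simp
    also have "(0, y) = (\<Sum>m\<in>UNIV. y $ m *\<^sub>R (0 :: real ^ 'b, axis m 1 :: real ^ 'b))"
      by (auto simp: prod_eq_iff fst_sum snd_sum basis_expansion scalar_mult_eq_scaleR[symmetric])
    also have "frechet_derivative ?g (at p) \<dots> = (\<Sum>m\<in>UNIV. y $ m * dy m ?g p)"
      using has_derivative_linear[OF diff] by (simp add: linear_sum linear_scale dy_def del: scaleR_Pair)
    finally show "(\<Sum>m\<in>UNIV. snd p $ m * dy m ?g p) = 2 * ?g p"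
      by (simp add: xy)
  qed
qed

lemma dy_comp_fst:
  assumes "h differentiable (at (fst p))"
  shows "dy k (\<lambda>q. h (fst q)) p = 0"
proof -
  have "((\<lambda>q. h (fst q)) has_derivative (\<lambda>v. frechet_derivative h (at (fst p)) (fst v))) (at p)"
    by (rule has_derivative_compose[OF bounded_linear_imp_has_derivative[OF bounded_linear_fst]])
       (use assms frechet_derivative_works in blast)
  then show ?thesis
    using linear_0[OF linear_frechet_derivative[OF assms]] by (simp add: dy_def frechet_derivative_eqI)
qed

theorem theorem1p2:
  fixes X :: "'m topology"
    and A :: "('m, 'n::finite) chart set"
    and G :: "('m, 'n) chart \<Rightarrow> 'n tpoint \<Rightarrow> 'n tpoint"
  assumes "smooth_manifold X A"
    and "CARD('n) \<ge> 3"
    and "spray A G"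
    and "scalar_curvature A G"
  shows "\<forall>\<sigma>. volume_form A \<sigma> \<longrightarrow>
           (\<forall>c\<in>A. \<forall>p\<in>slit c. \<forall>k. berwald_weyl (G c) (\<sigma> c) k p = 0)"
proof (intro allI impI ballI)
  fix \<sigma> c p k
  assume vol: "volume_form A \<sigma>" and c: "c \<in> A" and p: "p \<in> slit c"
  let ?V = "G c" and ?H = "projective_spray (G c) (\<sigma> c)" and ?n = "real CARD('n)"
  define P where "P = (\<lambda>q. - 1 / (?n + 1) * S_curvature ?V (\<sigma> c) q)"
  define L where "L = (\<lambda>q :: 'n tpoint. ln (\<sigma> c (fst q)))"
  have S: "S_curvature ?V (\<sigma> c) = (\<lambda>q. (\<Sum>m\<in>UNIV. Nc ?V m m q) - (\<Sum>m\<in>UNIV. snd q $ m * dx m L q))"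
    by (simp add: S_curvature_def[abs_def] Nc_def L_def)
  interpret V: local_spray "slit c" ?V
    by (rule spray_local[OF assms(1,3) c])
  have op: "open (chart_image c)"
    using assms(1) c by (auto simp: smooth_manifold_def is_chart_def)
  have smooth_ln: "smooth_on (chart_image c) (\<lambda>x. ln (\<sigma> c x))"
    using vol c Ck_on_ln[OF op, of "\<sigma> c"] by (auto simp: volume_form_def smooth_on_def)
  have smooth_L [simp]: "smooth_on (slit c) L"
  proof -
    have "fst ` slit c \<subseteq> chart_image c"
      by (auto simp: slit_def)
    from Ck_on_comp_linear[OF V.open_S bounded_linear_fst this] show ?thesis
      using smooth_ln unfolding L_def smooth_on_def by blast
  qed
  have dy_L: "dy j L q = 0" if "q \<in> slit c" for j q
  proof -
    interpret open_region "chart_image c" by unfold_locales (rule op)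
    show ?thesis
      unfolding L_def using that smooth_differentiable[OF smooth_ln]
      by (intro dy_comp_fst) (auto simp: slit_def)
  qed
  have dy_dx_L: "dy j (dx m L) q = 0" if "q \<in> slit c" for j m q
  proof -
    have "dx m (dy j L) q = dx m (\<lambda>_. 0) q"
      by (rule V.dx.cong[OF that]) (rule dy_L)
    then show ?thesis
      using that by (simp add: V.commute(3) V.dx.const)
  qed
  have smooth_P [simp]: "smooth_on (slit c) P"
    unfolding P_def S by (intro V.smooth_mult V.smooth_const V.smooth_diff V.smooth_sum) simp_all
  have euler_P: "V.euler P q = P q" if "q \<in> slit c" for q
  proof -
    have "V.euler (dx m L) q = 0" for m
      using that by (simp add: V.euler_def dy_dx_L)
    then show ?thesis
      unfolding P_def S using that
      by (subst V.euler.scale) (simp_all add: V.euler.diff V.euler.sum V.euler.mult V.euler.const V.euler_Nc)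
  qed
  interpret projective_change "slit c" ?V ?H P
  proof unfold_locales
    show "Gc ?H i q = Gc ?V i q + P q * snd q $ i" for q i
      by (simp add: Gc_def spray_coeff_def projective_spray_def P_def algebra_simps)
  qed (simp_all add: euler_P)
  obtain \<tau> where \<tau>: "scalar_spray (slit c) ?V \<tau>"
    using assms(2,4) c V.local_spray_axioms
    unfolding scalar_curvature_def scalar_spray_def scalar_spray_axioms_def by fastforce
  interpret H: closed_scalar_spray "slit c" ?H "\<lambda>k p. \<tau> k p
    - (\<Sum>l\<in>UNIV. (delta ?V k (dy l P) p - delta ?V l (dy k P) p) * snd p $ l)
    - (delta ?V k P p - P p * dy k P p)" "\<lambda>m. dx m L"
  proof (intro closed_scalar_spray.intro scalar_spray_H[OF \<tau>], unfold_locales)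
    fix q k l assume q: "q \<in> slit c"
    show "dx k (dx l L) q = dx l (dx k L) q"
      using q by (simp add: V.commute(1))
    show "dy k (dx l L) q = 0"
      by (rule dy_dx_L[OF q])
    \<comment> \<open>The factor \<open>- 1 / (n + 1)\<close> in \<open>P\<close> is the one for which the S-curvature of the new spray is zero.\<close>
    have "(\<Sum>m\<in>UNIV. Nc ?H m m q) = (\<Sum>m\<in>UNIV. Nc ?V m m q) + V.euler P q + ?n * P q"
      using q by (simp add: Nc_H sum.distrib V.euler_def mult.commute)
    also have "\<dots> = (\<Sum>m\<in>UNIV. Nc ?V m m q) + (?n + 1) * P q"
      using q by (simp add: euler_P algebra_simps)
    also have "(?n + 1) * P q = - S_curvature ?V (\<sigma> c) q"
      by (simp add: P_def add_eq_0_iff)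
    finally show "(\<Sum>m\<in>UNIV. Nc ?H m m q) = (\<Sum>m\<in>UNIV. snd q $ m * dx m L q)"
      by (simp add: S)
  qed (use assms(2) in simp_all)
  show "berwald_weyl (G c) (\<sigma> c) k p = 0"
    using H.berwald_weyl_expression_vanishes[OF p] by (simp only: berwald_weyl_def Let_def)
qed

end
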